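(* Let $p^{(j)}$, $j=0,1,\ldots$, be the iterates generated by the ORTHODIR algorithm applied to $(\mathcal{I}-\mathcal{T})\eta=g$ with initial guess $\mu^{(0)}=0$, and let $\eta^0=g$, $\eta^m=\mathcal{T}\eta^{m-1}$ ($m\ge1$) be the multiple scattering iterations. Each $p^{(j)}$ is a linear combination of $\eta^0,\ldots,\eta^j$, say $$p^{(j)}=\sum_{i=0}^{j}\gamma_{ij}\,\eta^i,$$ and this allows for the computation of the next iterate as $$p^{(j+1)}=(\mathcal{I}-\mathcal{T})p^{(j)}+\sum_{i=0}^{j}\beta_{ij}p^{(i)}=\sum_{i=0}^{j}\gamma_{ij}\,\eta^i-\sum_{i=0}^{j}\gamma_{ij}\,\eta^{i+1}+\sum_{i=0}^{j}\beta_{ij}\,p^{(i)}=\sum_{i=0}^{j+1}\gamma_{i,j+1}\,\eta^i,$$ where the new coefficients $\gamma_{i,j+1}$ are computed by identification (i.e. by inserting the representations of $p^{(0)},\ldots,p^{(j)}$ and collecting the coefficients of each $\eta^i$).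
   Context: Let $n\in\{2,3\}$ and let $\Omega\subset\mathbb{R}^n$ be a smooth compact obstacle, the union of finitely many disjoint sub-scatterers $\Omega_1,\ldots,\Omega_J$; $\nu$ is the exterior unit normal and $k>0$. Let $\Phi(x,y)=\frac{i}{4}H_0^{(1)}(k|x-y|)$ if $n=2$, $\Phi(x,y)=\frac{1}{4\pi}\frac{e^{ik|x-y|}}{|x-y|}$ if $n=3$, $G=-2\Phi$, and $(\mathcal{S}_{jj'}\mu)(x)=\int_{\partial\Omega_{j'}}(\partial_{\nu(x)}+ik)G(x,y)\mu(y)\,ds(y)$ for $x\in\partial\Omega_j$. Each $\mathcal{I}-\mathcal{S}_{jj}$ is boundedly invertible on $L^2(\partial\Omega_j)$. The operator $\mathcal{T}=(\mathcal{T}_{jj'})$ on $L^2(\partial\Omega)$ has entries $\mathcal{T}_{jj}=0$ and $\mathcal{T}_{jj'}=(\mathcal{I}-\mathcal{S}_{jj})^{-1}\mathcal{S}_{jj'}$ for $j\ne j'$. The right-hand side is $g=(g_1,\ldots,g_J)^t$, $g_j=(\mathcal{I}-\mathcal{S}_{jj})^{-1}f_j$, where $f_j$ is the restriction to $\partial\Omega_j$ of $f=2(\partial_\nu+ik)u^{\rm inc}$ and $u^{\rm inc}$ is an incident field satisfying the Helmholtz equation $(\Delta+k^2)u^{\rm inc}=0$ in $\mathbb{R}^n$. ORTHODIR algorithm for $\mathcal{A}\eta=g$, here with $\mathcal{A}=\mathcal{I}-\mathcal{T}$, and $\mu^{(0)}=0$ ($\langle\cdot,\cdot\rangle$ is the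 Hilbert space inner product; the iterates are considered as long as the divisions are well defined): set $r^{(0)}=p^{(0)}=g$; for $j=0,1,\ldots$ do (2.1) $\alpha_j=\langle r^{(j)},\mathcal{A}p^{(j)}\rangle/\langle\mathcal{A}p^{(j)},\mathcal{A}p^{(j)}\rangle$; (2.2) $\mu^{(j+1)}=\mu^{(j)}+\alpha_jp^{(j)}$; (2.3) $r^{(j+1)}=r^{(j)}-\alpha_j\mathcal{A}p^{(j)}$; (2.4) for $i=0,\ldots,j$, $\beta_{ij}=-\langle\mathcal{A}^2p^{(j)},\mathcal{A}p^{(i)}\rangle/\langle\mathcal{A}p^{(i)},\mathcal{A}p^{(i)}\rangle$; (2.5) $p^{(j+1)}=\mathcal{A}p^{(j)}+\sum_{i=0}^{j}\beta_{ij}p^{(i)}$. *)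

theory Defs
  imports "HOL-Analysis.Analysis"
begin

section \<open>Smooth obstacles, exterior normal, surface measure\<close>

primrec Ck_on :: "nat \<Rightarrow> (real^'n) set \<Rightarrow> (real^'n \<Rightarrow> 'b::real_normed_vector) \<Rightarrow> bool" where
  "Ck_on 0 U f \<longleftrightarrow> continuous_on U f"
| "Ck_on (Suc m) U f \<longleftrightarrow>
     (\<forall>x\<in>U. f differentiable (at x)) \<and>
     (\<forall>i. Ck_on m U (\<lambda>x. frechet_derivative f (at x) (axis i 1)))"

definition smooth_on :: "(real^'n) set \<Rightarrow> (real^'n \<Rightarrow> 'b::real_normed_vector) \<Rightarrow> bool" where
  "smooth_on U f \<longleftrightarrow> (\<forall>m. Ck_on m U f)"

text \<open>Near the boundary point \<open>x\<close> the set \<open>D\<close> is the sublevel set of a smooth function with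
  nonvanishing gradient \<open>v\<close> at \<open>x\<close>; such a gradient points out of \<open>D\<close>.\<close>

definition boundary_gradient :: "(real^'n) set \<Rightarrow> real^'n \<Rightarrow> real^'n \<Rightarrow> bool" where
  "boundary_gradient D x v \<longleftrightarrow>
     (\<exists>U \<rho>. open U \<and> x \<in> U \<and> smooth_on U \<rho> \<and> D \<inter> U = {y \<in> U. \<rho> y \<le> (0::real)} \<and>
            (GDERIV \<rho> x :> v) \<and> v \<noteq> 0)"

definition smooth_obstacle :: "(real^'n) set \<Rightarrow> bool" where
  "smooth_obstacle D \<longleftrightarrow> compact D \<and> D \<noteq> {} \<and> (\<forall>x\<in>frontier D. \<exists>v. boundary_gradient D x v)"

definition exterior_normal :: "(real^'n) set \<Rightarrow> real^'n \<Rightarrow> real^'n" where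
  "exterior_normal D x = (THE w. \<exists>v. boundary_gradient D x v \<and> w = sgn v)"

text \<open>Hausdorff measure of dimension \<open>d \<ge> 1\<close>, normalised so that it agrees with \<open>d\<close>-dimensional
  surface area.  Boundedness of the covering sets is required because \<^const>\<open>diameter\<close> is
  meaningless for unbounded sets.\<close>

definition hausdorff_content :: "nat \<Rightarrow> real \<Rightarrow> 'a::euclidean_space set \<Rightarrow> ennreal" where
  "hausdorff_content d \<delta> A =
     (INF C\<in>{C::nat \<Rightarrow> 'a set. A \<subseteq> (\<Union>i. C i) \<and> (\<forall>i. bounded (C i) \<and> diameter (C i) \<le> \<delta>)}.
        \<Sum>i. ennreal (unit_ball_vol (real d) * (diameter (C i) / 2) ^ d))"

definition hausdorff_measure :: "nat \<Rightarrow> 'a::euclidean_space measure" where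
  "hausdorff_measure d =
     measure_of UNIV (sets borel) (\<lambda>A. SUP \<delta>\<in>{0<..}. hausdorff_content d \<delta> A)"

definition boundary_measure :: "(real^'n) set \<Rightarrow> (real^'n) measure" where
  "boundary_measure D = restrict_space (hausdorff_measure (CARD('n) - 1)) (frontier D)"


section \<open>The Hilbert space of square integrable functions\<close>

text \<open>Elements are represented by functions; equality of elements is \<open>ae_eq\<close>.\<close>

definition l2_space :: "'a measure \<Rightarrow> ('a \<Rightarrow> complex) set" where
  "l2_space M = {f. f \<in> borel_measurable M \<and> integrable M (\<lambda>x. (cmod (f x))\<^sup>2)}"

definition ae_eq :: "'a measure \<Rightarrow> ('a \<Rightarrow> complex) \<Rightarrow> ('a \<Rightarrow> complex) \<Rightarrow> bool" where
  "ae_eq M f g \<longleftrightarrow> (AE x in M. f x = g x)"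

definition l2_inner :: "'a measure \<Rightarrow> ('a \<Rightarrow> complex) \<Rightarrow> ('a \<Rightarrow> complex) \<Rightarrow> complex" where
  "l2_inner M f g = (\<integral>x. f x * cnj (g x) \<partial>M)"

definition l2_norm :: "'a measure \<Rightarrow> ('a \<Rightarrow> complex) \<Rightarrow> real" where
  "l2_norm M f = sqrt (\<integral>x. (cmod (f x))\<^sup>2 \<partial>M)"

definition bounded_l2_operator ::
  "'a measure \<Rightarrow> (('a \<Rightarrow> complex) \<Rightarrow> ('a \<Rightarrow> complex)) \<Rightarrow> bool" where
  "bounded_l2_operator M A \<longleftrightarrow>
     (\<forall>f\<in>l2_space M. A f \<in> l2_space M) \<and>
     (\<forall>f\<in>l2_space M. \<forall>g\<in>l2_space M. ae_eq M (A (\<lambda>x. f x + g x)) (\<lambda>x. A f x + A g x)) \<and>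
     (\<forall>c. \<forall>f\<in>l2_space M. ae_eq M (A (\<lambda>x. c * f x)) (\<lambda>x. c * A f x)) \<and>
     (\<exists>C. \<forall>f\<in>l2_space M. l2_norm M (A f) \<le> C * l2_norm M f)"

definition boundedly_invertible ::
  "'a measure \<Rightarrow> (('a \<Rightarrow> complex) \<Rightarrow> ('a \<Rightarrow> complex)) \<Rightarrow> bool" where
  "boundedly_invertible M A \<longleftrightarrow> bounded_l2_operator M A \<and>
     (\<exists>B. bounded_l2_operator M B \<and>
          (\<forall>f\<in>l2_space M. ae_eq M (A (B f)) f \<and> ae_eq M (B (A f)) f))"

definition l2_inverse ::
  "'a measure \<Rightarrow> (('a \<Rightarrow> complex) \<Rightarrow> ('a \<Rightarrow> complex)) \<Rightarrow> ('a \<Rightarrow> complex) \<Rightarrow> ('a \<Rightarrow> complex)" where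
  "l2_inverse M A f = (SOME \<mu>. \<mu> \<in> l2_space M \<and> ae_eq M (A \<mu>) f)"

definition one_minus ::
  "(('a \<Rightarrow> complex) \<Rightarrow> ('a \<Rightarrow> complex)) \<Rightarrow> ('a \<Rightarrow> complex) \<Rightarrow> ('a \<Rightarrow> complex)" where
  "one_minus A \<mu> = (\<lambda>x. \<mu> x - A \<mu> x)"


section \<open>The Helmholtz equation and its fundamental solution\<close>

text \<open>Ascending series of the Bessel functions of order zero, for \<open>x > 0\<close>.\<close>

definition bessel_J0 :: "real \<Rightarrow> real" where
  "bessel_J0 x = (\<Sum>m. (-1) ^ m * (x\<^sup>2 / 4) ^ m / (fact m)\<^sup>2)"

definition bessel_Y0 :: "real \<Rightarrow> real" where
  "bessel_Y0 x = 2 / pi * (ln (x / 2) + euler_mascheroni) * bessel_J0 x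
     + 2 / pi * (\<Sum>m. (-1) ^ (m + 1) * harm m * (x\<^sup>2 / 4) ^ m / (fact m)\<^sup>2)"

definition hankel_H0 :: "real \<Rightarrow> complex" where
  "hankel_H0 x = complex_of_real (bessel_J0 x) + \<i> * complex_of_real (bessel_Y0 x)"

text \<open>The second branch is meant for dimension three.\<close>

definition fundamental_solution :: "real \<Rightarrow> real^'n \<Rightarrow> real^'n \<Rightarrow> complex" where
  "fundamental_solution k x y =
     (if CARD('n) = 2 then \<i> / 4 * hankel_H0 (k * norm (x - y))
      else 1 / (4 * complex_of_real pi) *
           (exp (\<i> * complex_of_real (k * norm (x - y))) / complex_of_real (norm (x - y))))"

definition green_G :: "real \<Rightarrow> real^'n \<Rightarrow> real^'n \<Rightarrow> complex" where
  "green_G k x y = - 2 * fundamental_solution k x y"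

text \<open>\<open>(\<partial>\<^sub>\<nu> + ik) u\<close> at \<open>x\<close>, where \<open>w\<close> is the direction \<open>\<nu>(x)\<close>.\<close>

definition impedance :: "real \<Rightarrow> (real^'n \<Rightarrow> complex) \<Rightarrow> real^'n \<Rightarrow> real^'n \<Rightarrow> complex" where
  "impedance k u x w = frechet_derivative u (at x) w + \<i> * complex_of_real k * u x"

definition laplacian :: "(real^'n \<Rightarrow> complex) \<Rightarrow> real^'n \<Rightarrow> complex" where
  "laplacian u x =
     (\<Sum>i\<in>UNIV. frechet_derivative (\<lambda>y. frechet_derivative u (at y) (axis i 1)) (at x) (axis i 1))"

definition helmholtz_solution :: "real \<Rightarrow> (real^'n \<Rightarrow> complex) \<Rightarrow> bool" where
  "helmholtz_solution k u \<longleftrightarrow>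
     Ck_on 2 UNIV u \<and> (\<forall>x. laplacian u x + (complex_of_real k)\<^sup>2 * u x = 0)"


section \<open>The multiple scattering operator\<close>

text \<open>Sub-scatterers are \<open>\<Omega> 1, \<dots>, \<Omega> J\<close>.  A density on the whole boundary is a function \<open>\<mu>\<close> on the
  ambient space, of which only the values on the boundary matter; its \<open>j\<close>-th component is its
  restriction to \<open>frontier (\<Omega> j)\<close>.\<close>

definition scatterer :: "nat \<Rightarrow> (nat \<Rightarrow> (real^'n) set) \<Rightarrow> (real^'n) set" where
  "scatterer J \<Omega> = (\<Union>j\<in>{1..J}. \<Omega> j)"

definition S_op :: "real \<Rightarrow> nat \<Rightarrow> (nat \<Rightarrow> (real^'n) set) \<Rightarrow> nat \<Rightarrow> nat \<Rightarrow>
    (real^'n \<Rightarrow> complex) \<Rightarrow> (real^'n \<Rightarrow> complex)" where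
  "S_op k J \<Omega> j j' \<mu> = (\<lambda>x. if x \<in> frontier (\<Omega> j) then
     (\<integral>y. impedance k (\<lambda>z. green_G k z y) x (exterior_normal (scatterer J \<Omega>) x) * \<mu> y
        \<partial>boundary_measure (\<Omega> j')) else 0)"

definition T_entry :: "real \<Rightarrow> nat \<Rightarrow> (nat \<Rightarrow> (real^'n) set) \<Rightarrow> nat \<Rightarrow> nat \<Rightarrow>
    (real^'n \<Rightarrow> complex) \<Rightarrow> (real^'n \<Rightarrow> complex)" where
  "T_entry k J \<Omega> j j' \<mu> =
     (if j = j' then (\<lambda>x. 0)
      else l2_inverse (boundary_measure (\<Omega> j)) (one_minus (S_op k J \<Omega> j j)) (S_op k J \<Omega> j j' \<mu>))"

definition T_op :: "real \<Rightarrow> nat \<Rightarrow> (nat \<Rightarrow> (real^'n) set) \<Rightarrow>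
    (real^'n \<Rightarrow> complex) \<Rightarrow> (real^'n \<Rightarrow> complex)" where
  "T_op k J \<Omega> \<mu> = (\<lambda>x. \<Sum>j\<in>{1..J}.
     if x \<in> frontier (\<Omega> j) then (\<Sum>j'\<in>{1..J}. T_entry k J \<Omega> j j' \<mu> x) else 0)"

definition boundary_data :: "real \<Rightarrow> nat \<Rightarrow> (nat \<Rightarrow> (real^'n) set) \<Rightarrow>
    (real^'n \<Rightarrow> complex) \<Rightarrow> (real^'n \<Rightarrow> complex)" where
  "boundary_data k J \<Omega> u = (\<lambda>x. 2 * impedance k u x (exterior_normal (scatterer J \<Omega>) x))"

definition rhs_g :: "real \<Rightarrow> nat \<Rightarrow> (nat \<Rightarrow> (real^'n) set) \<Rightarrow>
    (real^'n \<Rightarrow> complex) \<Rightarrow> (real^'n \<Rightarrow> complex)" where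
  "rhs_g k J \<Omega> u = (\<lambda>x. \<Sum>j\<in>{1..J}.
     if x \<in> frontier (\<Omega> j)
     then l2_inverse (boundary_measure (\<Omega> j)) (one_minus (S_op k J \<Omega> j j)) (boundary_data k J \<Omega> u) x
     else 0)"

text \<open>The family \<open>\<eta>\<close> with \<open>\<eta> 0 = g\<close> and \<open>\<eta> m = T (\<eta> (m - 1))\<close>.\<close>

primrec scattering_iter :: "real \<Rightarrow> nat \<Rightarrow> (nat \<Rightarrow> (real^'n) set) \<Rightarrow> (real^'n \<Rightarrow> complex) \<Rightarrow>
    nat \<Rightarrow> (real^'n \<Rightarrow> complex)" where
  "scattering_iter k J \<Omega> u 0 = rhs_g k J \<Omega> u"
| "scattering_iter k J \<Omega> u (Suc m) = T_op k J \<Omega> (scattering_iter k J \<Omega> u m)"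


section \<open>ORTHODIR\<close>

text \<open>The sequences are the outcome of the steps \<open>0, \<dots>, N - 1\<close> of the algorithm for \<open>A \<eta> = g\<close> with
  zero initial guess, all divisions in these steps being well defined.  Only the values of the
  iterates up to index \<open>N\<close>, and of the coefficients up to index \<open>N - 1\<close>, are constrained.\<close>

definition orthodir ::
  "'a measure \<Rightarrow> (('a \<Rightarrow> complex) \<Rightarrow> ('a \<Rightarrow> complex)) \<Rightarrow> ('a \<Rightarrow> complex) \<Rightarrow> nat \<Rightarrow>
   (nat \<Rightarrow> 'a \<Rightarrow> complex) \<Rightarrow> (nat \<Rightarrow> 'a \<Rightarrow> complex) \<Rightarrow> (nat \<Rightarrow> 'a \<Rightarrow> complex) \<Rightarrow>
   (nat \<Rightarrow> complex) \<Rightarrow> (nat \<Rightarrow> nat \<Rightarrow> complex) \<Rightarrow> bool" where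
  "orthodir M A g N \<mu> r p \<alpha> \<beta> \<longleftrightarrow>
     (\<forall>j\<le>N. \<mu> j \<in> l2_space M \<and> r j \<in> l2_space M \<and> p j \<in> l2_space M) \<and>
     ae_eq M (\<mu> 0) (\<lambda>x. 0) \<and> ae_eq M (r 0) g \<and> ae_eq M (p 0) g \<and>
     (\<forall>j<N.
        l2_inner M (A (p j)) (A (p j)) \<noteq> 0 \<and>
        \<alpha> j = l2_inner M (r j) (A (p j)) / l2_inner M (A (p j)) (A (p j)) \<and>
        ae_eq M (\<mu> (Suc j)) (\<lambda>x. \<mu> j x + \<alpha> j * p j x) \<and>
        ae_eq M (r (Suc j)) (\<lambda>x. r j x - \<alpha> j * A (p j) x) \<and>
        (\<forall>i\<le>j. \<beta> i j =
           - l2_inner M (A (A (p j))) (A (p i)) / l2_inner M (A (p i)) (A (p i))) \<and>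
        ae_eq M (p (Suc j)) (\<lambda>x. A (p j) x + (\<Sum>i\<le>j. \<beta> i j * p i x)))"

text \<open>Coefficient of \<open>\<eta> i\<close> in
  \<open>(\<Sum>i\<le>j. \<gamma> i j * \<eta> i) - (\<Sum>i\<le>j. \<gamma> i j * \<eta> (i + 1)) + (\<Sum>l\<le>j. \<beta> l j * (\<Sum>i\<le>l. \<gamma> i l * \<eta> i))\<close>.\<close>

definition next_coeff :: "(nat \<Rightarrow> nat \<Rightarrow> complex) \<Rightarrow> (nat \<Rightarrow> nat \<Rightarrow> complex) \<Rightarrow> nat \<Rightarrow> nat \<Rightarrow> complex" where
  "next_coeff \<gamma> \<beta> j i =
     (if i \<le> j then \<gamma> i j else 0) - (if 1 \<le> i then \<gamma> (i - 1) j else 0)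
     + (\<Sum>l\<in>{i..j}. \<beta> l j * \<gamma> i l)"

end

theory Submission
  imports Defs
begin

text \<open>By linearity \<open>A p = p - T p\<close> sends \<open>\<Sum>i\<le>j. \<gamma> i * \<eta> i\<close> to
  \<open>\<Sum>i\<le>j. \<gamma> i * (\<eta> i - \<eta> (i + 1))\<close>, and the expansion of \<open>p (j + 1)\<close> follows by collecting
  coefficients.  The substance lies in the well-definedness of \<open>T\<close> as a linear operator on
  square integrable functions modulo null sets: the choice in \<^const>\<open>l2_inverse\<close> returns a solution only
  for square integrable data.  The data are square integrable because they are continuous (the
  exterior normal is continuous, and the kernel coupling two disjoint compact boundaries is not
  singular) and because a compact smooth boundary, being locally a Lipschitz graph, has finite
  Hausdorff measure.\<close>

section \<open>The exterior normal\<close>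

text \<open>\<open>T_op\<close> acts on functions, and neither its linearity nor its compatibility
  with null sets is assumed. Both come from its two layers. An off-diagonal \<open>S_op\<close> is
  an integral, hence linear at every point and blind to null sets of the density. The inverse
  applied afterwards is linear only almost everywhere: the solutions for a combination and for its
  terms are chosen independently, and injectivity relates them.

  Kernel and data use the normal of the whole union, while smoothness and invertibility are given
  one sub-scatterer at a time. Disjointness and compactness reconcile the two: near a boundary point
  the union coincides with a single sub-scatterer, so gradients and normals can be compared locally.

  The coefficients cannot be read off from the directions, because the scattering iterates may be
  linearly dependent. They are therefore built beforehand by a recursion involving only \<beta>, and
  the expansions are then verified by induction.\<close>

lemma Ck_on_subset: "Ck_on m U f \<Longrightarrow> V \<subseteq> U \<Longrightarrow> Ck_on m V f"
proof (induction m arbitrary: f)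
  case 0
  then show ?case by (auto intro: continuous_on_subset)
next
  case (Suc m)
  then show ?case by auto
qed

lemma frechet_derivative_coordinates:
  fixes f :: "real^'n \<Rightarrow> 'b::real_normed_vector"
  assumes "f differentiable (at x)"
  shows "frechet_derivative f (at x) w
    = (\<Sum>l\<in>UNIV. (w $ l) *\<^sub>R frechet_derivative f (at x) (axis l 1))"
proof -
  have lin: "linear (frechet_derivative f (at x))"
    using assms by (rule linear_frechet_derivative)
  have "frechet_derivative f (at x) w = frechet_derivative f (at x) (\<Sum>l\<in>UNIV. (w $ l) *\<^sub>R axis l 1)"
    using basis_expansion[of w] by (simp add: scalar_mult_eq_scaleR)
  also have "\<dots> = (\<Sum>l\<in>UNIV. (w $ l) *\<^sub>R frechet_derivative f (at x) (axis l 1))"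
    by (simp add: linear_sum[OF lin] linear_cmul[OF lin])
  finally show ?thesis .
qed

lemma continuous_on_frechet_derivative_axis:
  assumes "Ck_on (Suc (Suc m)) U f"
  shows "continuous_on U (\<lambda>x. frechet_derivative f (at x) (axis l 1))"
proof -
  have "\<forall>x\<in>U. (\<lambda>x. frechet_derivative f (at x) (axis l 1)) differentiable (at x)"
    using assms by simp
  then show ?thesis
    by (intro continuous_at_imp_continuous_on) (auto intro: differentiable_imp_continuous_within)
qed

lemma frechet_derivative_GDERIV:
  assumes "GDERIV \<rho> x :> v"
  shows "frechet_derivative \<rho> (at x) w = w \<bullet> v"
  using frechet_derivative_at[OF assms[unfolded gderiv_def]] by metis

text \<open>A point of the closed set \<open>D\<close> with \<open>\<rho> x < 0\<close> would, by
  continuity, have a whole neighbourhood inside the sublevel set and thus be interior.\<close>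

lemma frontier_level_zero:
  fixes \<rho> :: "real^'n \<Rightarrow> real"
  assumes "closed D" "open U" "smooth_on U \<rho>" "D \<inter> U = {y \<in> U. \<rho> y \<le> 0}" "x \<in> frontier D" "x \<in> U"
  shows "\<rho> x = 0"
proof (rule ccontr)
  assume ne: "\<rho> x \<noteq> 0"
  have cont: "continuous_on U \<rho>"
    using assms(3) unfolding smooth_on_def by (metis Ck_on.simps(1))
  have "x \<in> D" using assms(1,5) by (auto simp: frontier_def)
  then have "\<rho> x < 0" using ne assms(4,6) by (auto simp: set_eq_iff less_le)
  moreover have "open (\<rho> -` {..<0} \<inter> U)"
    using iffD1[OF continuous_on_open_vimage[OF assms(2)] cont] by simp
  then have "open {y \<in> U. \<rho> y < 0}"
    by (simp add: vimage_def Int_def conj_commute)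
  moreover have "{y \<in> U. \<rho> y < 0} \<subseteq> D" using assms(4) by fastforce
  ultimately have "x \<in> interior D" using assms(6) by (auto intro: interiorI)
  then show False using assms(5) by (auto simp: frontier_def)
qed

text \<open>On the ray with direction \<open>w\<close> the function has derivative
  \<open>w \<bullet> v\<close> at 0. This turns a statement about gradients into one about
  membership in \<open>D\<close>, where two different defining functions can be compared.\<close>

lemma GDERIV_pos_increase:
  fixes \<rho> :: "'a::real_inner \<Rightarrow> real"
  assumes "GDERIV \<rho> x :> v" "w \<bullet> v > 0"
  shows "eventually (\<lambda>t. \<rho> (x + t *\<^sub>R w) > \<rho> x) (at_right 0)"
proof -
  have "((\<lambda>t. \<rho> (x + t *\<^sub>R w)) has_derivative (\<lambda>t. (t *\<^sub>R w) \<bullet> v)) (at 0)"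
  proof (rule has_derivative_compose[of "\<lambda>t. x + t *\<^sub>R w" "\<lambda>t. t *\<^sub>R w" 0 UNIV \<rho> "\<lambda>h. h \<bullet> v"])
    show "((\<lambda>t. x + t *\<^sub>R w) has_derivative (\<lambda>t. t *\<^sub>R w)) (at 0)"
      by (auto intro!: derivative_eq_intros)
    show "(\<rho> has_derivative (\<lambda>h. h \<bullet> v)) (at (x + 0 *\<^sub>R w))"
      using assms(1) by (simp add: gderiv_def)
  qed
  then have "DERIV (\<lambda>t. \<rho> (x + t *\<^sub>R w)) 0 :> w \<bullet> v"
    by (simp add: has_field_derivative_def mult.commute[of _ "w \<bullet> v"])
  from DERIV_pos_inc_right[OF this assms(2)] obtain d where
    "d > 0" "\<And>h. 0 < h \<Longrightarrow> h < d \<Longrightarrow> \<rho> (x + 0 *\<^sub>R w) < \<rho> (x + h *\<^sub>R w)" by auto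
  then show ?thesis
    unfolding eventually_at_right_field by (intro exI[of _ d]) auto
qed

text \<open>If the unit gradients differ, their difference \<open>w\<close> has negative product
  with \<open>v\<close> and positive product with \<open>v'\<close>. A short move along
  \<open>w\<close> then stays in \<open>D\<close> according to \<open>\<rho>\<close> and leaves it
  according to \<open>\<rho>'\<close>. Uniqueness is what gives the definite description in
  \<open>exterior_normal\<close> a meaning.\<close>

lemma boundary_gradient_direction_unique:
  fixes D :: "(real^'n) set"
  assumes "closed D" "x \<in> frontier D" "boundary_gradient D x v" "boundary_gradient D x v'"
  shows "sgn v = sgn v'"
proof (rule ccontr)
  assume ne: "sgn v \<noteq> sgn v'"
  obtain U \<rho> where U: "open U" "x \<in> U" "smooth_on U \<rho>" "D \<inter> U = {y \<in> U. \<rho> y \<le> 0}"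
      "GDERIV \<rho> x :> v" "v \<noteq> 0"
    using assms(3) unfolding boundary_gradient_def by blast
  obtain U' \<rho>' where U': "open U'" "x \<in> U'" "smooth_on U' \<rho>'" "D \<inter> U' = {y \<in> U'. \<rho>' y \<le> 0}"
      "GDERIV \<rho>' x :> v'" "v' \<noteq> 0"
    using assms(4) unfolding boundary_gradient_def by blast
  have zero: "\<rho> x = 0" "\<rho>' x = 0"
    using frontier_level_zero assms(1,2) U(1-4) U'(1-4) by blast+
  define w where "w = sgn v' - sgn v"
  have n1: "norm (sgn v) = 1" "norm (sgn v') = 1" using U(6) U'(6) by (auto simp: norm_sgn)
  have "0 < (norm w)\<^sup>2" using ne by (simp add: w_def)
  also have "(norm w)\<^sup>2 = 2 - 2 * (sgn v \<bullet> sgn v')"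
    using n1 dot_norm_neg[of "sgn v'" "sgn v"] unfolding w_def by (simp add: inner_commute field_simps)
  finally have lt: "sgn v \<bullet> sgn v' < 1" by simp
  have vv: "v = norm v *\<^sub>R sgn v" "v' = norm v' *\<^sub>R sgn v'"
    using U(6) U'(6) by (auto simp: sgn_div_norm)
  have ii: "sgn v \<bullet> sgn v = 1" "sgn v' \<bullet> sgn v' = 1"
    using n1 by (simp_all add: power2_norm_eq_inner[symmetric])
  have "w \<bullet> v = norm v * (w \<bullet> sgn v)" by (subst vv(1)) simp
  also have "w \<bullet> sgn v < 0" using lt ii by (simp add: w_def inner_diff_left inner_diff_right inner_commute)
  finally have neg: "w \<bullet> v < 0" using U(6) by (simp add: mult_pos_neg)
  have "w \<bullet> v' = norm v' * (w \<bullet> sgn v')" by (subst vv(2)) simp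
  moreover have "w \<bullet> sgn v' > 0" using lt ii by (simp add: w_def inner_diff_left inner_diff_right inner_commute)
  ultimately have pos: "w \<bullet> v' > 0" using U'(6) by simp
  have "GDERIV (\<lambda>y. - \<rho> y) x :> - v" using U(5) by (rule GDERIV_minus)
  from GDERIV_pos_increase[OF this, of w] neg zero
  have e1: "eventually (\<lambda>t. \<rho> (x + t *\<^sub>R w) < 0) (at_right 0)" by simp
  from GDERIV_pos_increase[OF U'(5) pos] zero
  have e2: "eventually (\<lambda>t. \<rho>' (x + t *\<^sub>R w) > 0) (at_right 0)" by simp
  have lim: "((\<lambda>t. x + t *\<^sub>R w) \<longlongrightarrow> x + 0 *\<^sub>R w) (at_right 0)"
    by (intro tendsto_intros)
  have e3: "eventually (\<lambda>t. x + t *\<^sub>R w \<in> U \<inter> U') (at_right 0)"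
    using topological_tendstoD[OF lim, of "U \<inter> U'"] U(1,2) U'(1,2) by auto
  have "eventually (\<lambda>t::real. False) (at_right 0)"
    using e1 e2 e3
  proof eventually_elim
    case (elim t)
    let ?y = "x + t *\<^sub>R w"
    have "?y \<in> D \<inter> U" using elim U(4) by simp
    moreover have "?y \<notin> D \<inter> U'" using elim U'(4) by simp
    ultimately show False using elim by blast
  qed
  then show False by (simp add: trivial_limit_at_right_real)
qed

lemma exterior_normal_eq:
  assumes "closed D" "x \<in> frontier D" "boundary_gradient D x v"
  shows "exterior_normal D x = sgn v"
  unfolding exterior_normal_def
  using assms boundary_gradient_direction_unique by (intro the_equality) blast+

text \<open>The defining function at \<open>x\<close> also serves all nearby frontier points, since
  its gradient field stays nonzero there. Hence the normal coincides locally with the normalised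
  gradient of one fixed function.\<close>

lemma continuous_on_exterior_normal:
  fixes D :: "(real^'n) set"
  assumes "smooth_obstacle D"
  shows "continuous_on (frontier D) (exterior_normal D)"
  unfolding continuous_on_eq_continuous_within
proof
  fix x assume x: "x \<in> frontier D"
  have cl: "closed D" using assms by (auto simp: smooth_obstacle_def compact_imp_closed)
  obtain v U \<rho> where U: "open U" "x \<in> U" "smooth_on U \<rho>" "D \<inter> U = {y \<in> U. \<rho> y \<le> 0}"
      "GDERIV \<rho> x :> v" "v \<noteq> 0"
    using assms x unfolding smooth_obstacle_def boundary_gradient_def by blast
  \<comment> \<open>\<open>smooth_on\<close> controls derivatives along the axes, so the gradient
    field is assembled from them; its continuity follows coordinatewise.\<close>
  define G where "G = (\<lambda>y. \<Sum>l\<in>UNIV. frechet_derivative \<rho> (at y) (axis l 1) *\<^sub>R (axis l 1 :: real^'n))"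
  have C2: "Ck_on (Suc (Suc 0)) U \<rho>" using U(3) by (simp add: smooth_on_def)
  have diff: "\<rho> differentiable (at y)" if "y \<in> U" for y using C2 that by simp
  have cG: "continuous_on U G"
    unfolding G_def by (intro continuous_intros continuous_on_frechet_derivative_axis[OF C2])
  have GD: "GDERIV \<rho> y :> G y" if "y \<in> U" for y
  proof -
    have "(\<rho> has_derivative frechet_derivative \<rho> (at y)) (at y)"
      using diff[OF that] frechet_derivative_works by blast
    moreover have "frechet_derivative \<rho> (at y) = (\<lambda>h. h \<bullet> G y)"
    proof
      fix h show "frechet_derivative \<rho> (at y) h = h \<bullet> G y"
        unfolding G_def frechet_derivative_coordinates[OF diff[OF that], of h]
        by (simp add: inner_sum_right inner_axis mult.commute)
    qed
    ultimately show ?thesis unfolding gderiv_def by simp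
  qed
  have Gx: "G x = v"
  proof -
    have "(G x - v) \<bullet> G x = (G x - v) \<bullet> v"
      using frechet_derivative_GDERIV[OF GD[OF U(2)]] frechet_derivative_GDERIV[OF U(5)] by metis
    then have "(G x - v) \<bullet> (G x - v) = 0" by (simp add: inner_diff_right)
    then show ?thesis by simp
  qed
  have at: "isCont G x" using cG U(1,2) by (simp add: continuous_on_eq_continuous_at)
  have "eventually (\<lambda>y. G y \<noteq> 0) (nhds x)"
  proof -
    have "(G \<longlongrightarrow> G x) (nhds x)"
      using at tendsto_at_iff_tendsto_nhds[of G x] by (simp add: isCont_def)
    then show ?thesis using tendsto_imp_eventually_ne[of G "G x" "nhds x" 0] Gx U(6) by simp
  qed
  moreover have "eventually (\<lambda>y. y \<in> U) (nhds x)" using U(1,2) eventually_nhds by blast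
  ultimately have ev: "eventually (\<lambda>y. y \<in> frontier D \<longrightarrow> sgn (G y) = exterior_normal D y) (nhds x)"
  proof eventually_elim
    case (elim y)
    have "boundary_gradient D y (G y)" unfolding boundary_gradient_def
      by (intro exI[of _ U] exI[of _ \<rho>] conjI U(1,3,4) elim GD[OF elim(2)])
    then show ?case using exterior_normal_eq[OF cl, of y "G y"] by simp
  qed
  have "continuous (at x within frontier D) (\<lambda>y. sgn (G y))"
    using at Gx U(6) by (auto intro!: continuous_at_imp_continuous_at_within[OF isCont_sgn])
  moreover have "eventually (\<lambda>y. sgn (G y) = exterior_normal D y) (at x within frontier D)"
    unfolding eventually_at_filter using ev by (rule eventually_mono) simp
  moreover have "sgn (G x) = exterior_normal D x"
    using eventually_nhds_x_imp_x[OF ev] x by blast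
  ultimately show "continuous (at x within frontier D) (exterior_normal D)"
    unfolding continuous_within by (auto intro: Lim_transform_eventually)
qed

section \<open>Locality of frontiers and boundary gradients\<close>

lemma frontier_cong_open:
  assumes "open V" "x \<in> V" "A \<inter> V = B \<inter> V"
  shows "x \<in> frontier A \<longleftrightarrow> x \<in> frontier B"
proof -
  have loc: "x \<in> interior S \<longleftrightarrow> x \<in> interior (S \<inter> V)" for S
    using assms(1,2) by (simp add: interior_open)
  have "- A \<inter> V = - B \<inter> V" using assms(3) by blast
  then have "x \<in> interior A \<longleftrightarrow> x \<in> interior B" "x \<in> interior (- A) \<longleftrightarrow> x \<in> interior (- B)"
    using loc assms(3) by metis+
  then show ?thesis by (auto simp: frontier_def closure_interior)
qed

text \<open>Shrinking the chart to \<open>U \<inter> V\<close> suffices. This carries gradients from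
  a sub-scatterer to the union.\<close>

lemma boundary_gradient_cong_open:
  assumes "open V" "x \<in> V" "A \<inter> V = B \<inter> V" "boundary_gradient A x v"
  shows "boundary_gradient B x v"
proof -
  obtain U \<rho> where U: "open U" "x \<in> U" "smooth_on U \<rho>" "A \<inter> U = {y \<in> U. \<rho> y \<le> 0}"
      "GDERIV \<rho> x :> v" "v \<noteq> 0"
    using assms(4) unfolding boundary_gradient_def by blast
  have "smooth_on (U \<inter> V) \<rho>" using U(3) Ck_on_subset[of _ U \<rho> "U \<inter> V"] by (simp add: smooth_on_def)
  moreover have "B \<inter> (U \<inter> V) = {y \<in> U \<inter> V. \<rho> y \<le> 0}" using U(4) assms(3) by blast
  ultimately show ?thesis unfolding boundary_gradient_def
    using U assms(1,2) by (intro exI[of _ "U \<inter> V"] exI[of _ \<rho>]) auto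
qed

section \<open>Finite Hausdorff measure of smooth boundaries\<close>

lemma sets_hausdorff_measure [simp]:
  "sets (hausdorff_measure d :: 'a::euclidean_space measure) = sets borel"
  unfolding hausdorff_measure_def using sets.sigma_sets_eq[of "borel :: 'a measure"] by simp

lemma space_hausdorff_measure [simp]: "space (hausdorff_measure d) = UNIV"
  unfolding hausdorff_measure_def by simp

text \<open>\<^const>\<open>measure_of\<close> is \<open>0\<close> if the set function is not a measure, so the upper bound holds in either case
  and Caratheodory's theorem is not needed.\<close>

lemma emeasure_hausdorff_measure_le:
  assumes "\<And>\<delta>. \<delta> > 0 \<Longrightarrow> hausdorff_content d \<delta> A \<le> B"
  shows "emeasure (hausdorff_measure d) A \<le> B"
  unfolding hausdorff_measure_def emeasure_measure_of_conv
  using assms by (auto intro: SUP_least)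

text \<open>The content is defined by sequences of sets, so a finite cover is padded with empty
  sets. These contribute 0 because their diameter is 0 and \<open>d \<ge> 1\<close> makes
  \<open>0 ^ d\<close> vanish.\<close>

lemma hausdorff_content_le_finite_cover:
  fixes A :: "'a::euclidean_space set"
  assumes "finite I" "A \<subseteq> (\<Union>i\<in>I. C i)" "\<And>i. i \<in> I \<Longrightarrow> bounded (C i)"
    "\<And>i. i \<in> I \<Longrightarrow> diameter (C i) \<le> e" "0 \<le> e" "e \<le> \<delta>" "d \<ge> 1"
  shows "hausdorff_content d \<delta> A
    \<le> ennreal (real (card I) * (unit_ball_vol (real d) * (e / 2) ^ d))"
proof -
  obtain h where h: "bij_betw h {0..<card I} I"
    using assms(1) ex_bij_betw_nat_finite by blast
  define C' where "C' n = (if n < card I then C (h n) else {})" for n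
  have hI: "h n \<in> I" if "n < card I" for n using h that by (auto simp: bij_betw_def)
  have "A \<subseteq> (\<Union>n. C' n)"
  proof
    fix x assume "x \<in> A"
    then obtain i where "i \<in> I" "x \<in> C i" using assms(2) by blast
    then obtain n where "n < card I" "h n = i"
      using bij_betw_imp_surj_on[OF h] by (metis atLeastLessThan_iff imageE)
    then have "x \<in> C' n" using \<open>x \<in> C i\<close> by (simp add: C'_def)
    then show "x \<in> (\<Union>n. C' n)" by blast
  qed
  moreover have "bounded (C' n)" "diameter (C' n) \<le> \<delta>" for n
    using assms(3-6) hI by (auto simp: C'_def intro: order_trans)
  ultimately have "hausdorff_content d \<delta> A
      \<le> (\<Sum>n. ennreal (unit_ball_vol (real d) * (diameter (C' n) / 2) ^ d))"
    unfolding hausdorff_content_def by (intro INF_lower) auto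
  also have "\<dots> = (\<Sum>n<card I. ennreal (unit_ball_vol (real d) * (diameter (C' n) / 2) ^ d))"
    using assms(7) by (intro suminf_finite) (auto simp: C'_def diameter_empty)
  also have "\<dots> \<le> (\<Sum>n<card I. ennreal (unit_ball_vol (real d) * (e / 2) ^ d))"
  proof (intro sum_mono ennreal_leI mult_left_mono power_mono divide_right_mono)
    fix n assume "n \<in> {..<card I}"
    then show "diameter (C' n) \<le> e" using assms(4) hI by (auto simp: C'_def)
    show "0 \<le> diameter (C' n) / 2" using diameter_ge_0[OF \<open>\<And>n. bounded (C' n)\<close>] by simp
  qed auto
  also have "\<dots> = ennreal (real (card I) * (unit_ball_vol (real d) * (e / 2) ^ d))"
    using assms(5) by (simp add: ennreal_mult ennreal_of_nat_eq_real_of_nat)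
  finally show ?thesis .
qed

text \<open>Cut the projection of \<open>A\<close> along the \<open>i\<close>-th axis into \<open>O(m ^ (CARD('n) - 1))\<close> cubes of side
  \<open>O(1/m)\<close>: the parts of \<open>A\<close> above them have diameter \<open>O(1/m)\<close>.\<close>

lemma hausdorff_content_Lipschitz_graph:
  fixes A :: "(real^'n) set"
  assumes d: "CARD('n) \<ge> 2" and s: "s > 0" and L: "L > 0"
    and box: "\<And>y l. y \<in> A \<Longrightarrow> \<bar>y $ l - x $ l\<bar> \<le> s"
    and lip: "\<And>y y'. y \<in> A \<Longrightarrow> y' \<in> A \<Longrightarrow> norm (y - y') \<le> L * (\<Sum>l\<in>UNIV - {i}. \<bar>y $ l - y' $ l\<bar>)"
    and \<delta>: "\<delta> > 0"
  shows "hausdorff_content (CARD('n) - 1) \<delta> A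
    \<le> ennreal (unit_ball_vol (real (CARD('n) - 1)) * (2 * L * real (CARD('n) - 1) * s) ^ (CARD('n) - 1))"
proof -
  define D where "D = CARD('n) - 1"
  have D1: "D \<ge> 1" using d by (simp add: D_def)
  have cardD: "card (UNIV - {i} :: 'n set) = D" by (simp add: D_def card_Diff_singleton)
  \<comment> \<open>The grid has side \<open>2 * s / m\<close>. Points of \<open>A\<close> over one
    cell are at distance at most \<open>L * D * (2 * s / m)\<close>, and the lower bound on
    \<open>m\<close> says that this is less than \<open>\<delta>\<close>.\<close>
  obtain m :: nat where m: "m > 2 * L * D * s / \<delta>" "m \<ge> 1"
    by (metis One_nat_def Suc_leI gr0I less_le_trans not_less of_nat_0 of_nat_le_iff order_less_imp_le reals_Archimedean2 linorder_le_cases)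
  define e where "e = L * (real D * (2 * s / m))"
  have e0: "e \<ge> 0" using L s by (simp add: e_def)
  have "e \<le> \<delta>" using m \<delta> by (simp add: e_def field_simps)
  \<comment> \<open>\<open>\<kappa> y l\<close> is the index of the cell in direction
    \<open>l\<close>. The far end \<open>y $ l - x $ l = s\<close> gets index \<open>m\<close>, so
    there are \<open>m + 1\<close> indices per axis.\<close>
  define \<kappa> where "\<kappa> y l = nat \<lfloor>real m * (y $ l - x $ l + s) / (2 * s)\<rfloor>" for y l
  define I where "I = PiE (UNIV - {i} :: 'n set) (\<lambda>_. {..m})"
  define C where "C f = {y \<in> A. \<forall>l\<in>UNIV - {i}. \<kappa> y l = f l}" for f
  have cover: "A \<subseteq> (\<Union>f\<in>I. C f)"
  proof
    fix y assume y: "y \<in> A"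
    have "\<kappa> y l \<le> m" for l
    proof -
      have "real m * (y $ l - x $ l + s) / (2 * s) \<le> real m * (2 * s) / (2 * s)"
        using box[OF y, of l] s by (intro divide_right_mono mult_left_mono) auto
      also have "\<dots> = real m" using s by simp
      finally show ?thesis unfolding \<kappa>_def by linarith
    qed
    then have "restrict (\<kappa> y) (UNIV - {i}) \<in> I" by (auto simp: I_def)
    moreover have "y \<in> C (restrict (\<kappa> y) (UNIV - {i}))" using y by (auto simp: C_def)
    ultimately show "y \<in> (\<Union>f\<in>I. C f)" by blast
  qed
  have close: "norm (y - y') \<le> e" if y: "y \<in> C f" "y' \<in> C f" for f y y'
  proof -
    have yA: "y \<in> A" "y' \<in> A" using y by (auto simp: C_def)
    have "\<bar>y $ l - y' $ l\<bar> \<le> 2 * s / m" if l: "l \<noteq> i" for l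
    proof -
      let ?q = "\<lambda>y. real m * (y $ l - x $ l + s) / (2 * s)"
      have eq: "\<kappa> y l = \<kappa> y' l" using y l by (auto simp: C_def)
      \<comment> \<open>Nonnegativity prevents \<open>nat\<close> from identifying different
        negative floors; equal indices then mean equal floors.\<close>
      have "?q z \<ge> 0" if "z \<in> A" for z using box[OF that, of l] s by (auto intro!: divide_nonneg_pos)
      then have "?q y \<ge> 0" "?q y' \<ge> 0" using yA by auto
      then have "\<bar>?q y - ?q y'\<bar> \<le> 1" using eq unfolding \<kappa>_def by linarith
      also have "?q y - ?q y' = real m / (2 * s) * (y $ l - y' $ l)"
        using s by (simp add: field_simps)
      finally have "real m / (2 * s) * \<bar>y $ l - y' $ l\<bar> \<le> 1"
        using s m by (simp add: abs_mult)
      then show ?thesis using s m by (simp add: field_simps)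
    qed
    then have "(\<Sum>l\<in>UNIV - {i}. \<bar>y $ l - y' $ l\<bar>) \<le> real D * (2 * s / m)"
      using sum_bounded_above[of "UNIV - {i}" "\<lambda>l. \<bar>y $ l - y' $ l\<bar>" "2 * s / m"] cardD by auto
    then show ?thesis using lip[OF yA] L unfolding e_def
      by (meson mult_left_mono order_trans less_imp_le)
  qed
  have "hausdorff_content D \<delta> A \<le> ennreal (real (card I) * (unit_ball_vol (real D) * (e / 2) ^ D))"
  proof (rule hausdorff_content_le_finite_cover[OF _ cover])
    show "finite I" by (auto simp: I_def intro: finite_PiE)
    show "bounded (C f)" for f
      by (rule bounded_two_points[THEN iffD2]) (use close in \<open>auto simp: dist_norm\<close>)
    show "diameter (C f) \<le> e" for f
      using close e0 by (intro diameter_le) auto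
  qed (use e0 \<open>e \<le> \<delta>\<close> D1 in auto)
  also have "\<dots> \<le> ennreal (unit_ball_vol (real D) * (2 * L * real D * s) ^ D)"
  proof (rule ennreal_leI)
    have "real (card I) = (real m + 1) ^ D" by (simp add: I_def card_PiE cardD add.commute)
    \<comment> \<open>The estimate \<open>m + 1 \<le> 2 * m\<close> absorbs the extra index. The
      factor \<open>m\<close> then cancels against the \<open>1 / m\<close> in \<open>e\<close>,
      which makes the final bound independent of \<open>\<delta>\<close>.\<close>
    also have "\<dots> \<le> (2 * real m) ^ D" using m by (intro power_mono) auto
    finally have "real (card I) * (e / 2) ^ D \<le> (2 * real m) ^ D * (e / 2) ^ D"
      using e0 by (intro mult_right_mono) auto
    also have "\<dots> = (2 * L * real D * s) ^ D"
    proof -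
      have "2 * real m * (e / 2) = 2 * L * real D * s" using m by (simp add: e_def)
      then show ?thesis unfolding power_mult_distrib[symmetric] by simp
    qed
    finally show "real (card I) * (unit_ball_vol (real D) * (e / 2) ^ D)
        \<le> unit_ball_vol (real D) * (2 * L * real D * s) ^ D"
      using mult_left_mono[of "real (card I) * (e / 2) ^ D" _ "unit_ball_vol (real D)"]
      by (simp add: mult.left_commute)
  qed
  finally show ?thesis by (simp add: D_def)
qed

text \<open>By the mean value theorem a level set of \<open>\<rho>\<close> is a Lipschitz graph over the coordinate
  hyperplane orthogonal to an axis along which \<open>\<rho>\<close> is strictly monotone.\<close>

lemma frontier_locally_finite_hausdorff:
  fixes D :: "(real^'n) set"
  assumes dim: "CARD('n) \<ge> 2" and D: "smooth_obstacle D" and x: "x \<in> frontier D"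
  shows "\<exists>W. open W \<and> x \<in> W \<and> emeasure (hausdorff_measure (CARD('n) - 1)) (W \<inter> frontier D) < \<infinity>"
proof -
  have cl: "closed D" using D by (auto simp: smooth_obstacle_def compact_imp_closed)
  obtain v U \<rho> where U: "open U" "x \<in> U" "smooth_on U \<rho>" "D \<inter> U = {y \<in> U. \<rho> y \<le> 0}"
      "GDERIV \<rho> x :> v" "v \<noteq> 0"
    using D x unfolding smooth_obstacle_def boundary_gradient_def by blast
  have C2: "Ck_on (Suc (Suc 0)) U \<rho>" using U(3) by (simp add: smooth_on_def)
  have diff: "\<rho> differentiable (at y)" if "y \<in> U" for y using C2 that by simp
  define P where "P l y = frechet_derivative \<rho> (at y) (axis l 1)" for l y
  have cP: "continuous_on U (P l)" for l
    unfolding P_def by (rule continuous_on_frechet_derivative_axis[OF C2])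
  obtain i where i: "v $ i \<noteq> 0" using U(6) by (metis vec_eq_iff zero_index)
  have Px: "P l x = v $ l" for l
    unfolding P_def frechet_derivative_GDERIV[OF U(5)] by (simp add: inner_axis')
  \<comment> \<open>The partial derivatives at \<open>x\<close> are the coordinates of
    \<open>v\<close>. Halving \<open>\<bar>v $ i\<bar>\<close> and adding 1 to \<open>norm v\<close>
    leaves room for these bounds to persist on a neighbourhood.\<close>
  define c where "c = \<bar>v $ i\<bar> / 2"
  define K where "K = norm v + 1"
  have c: "c > 0" "\<bar>P i x\<bar> > c" using i Px by (auto simp: c_def)
  have K: "K > 0" "\<bar>P l x\<bar> < K" for l
    using component_le_norm_cart[of v l] norm_ge_zero[of v] by (auto simp: K_def Px simp del: norm_ge_zero)
  have at: "(P l \<longlongrightarrow> P l x) (nhds x)" for l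
    using cP U(1,2) by (simp add: continuous_on_eq_continuous_at isCont_def tendsto_at_iff_tendsto_nhds)
  have "eventually (\<lambda>y. y \<in> U \<and> \<bar>P i y\<bar> > c \<and> (\<forall>l\<in>UNIV. \<bar>P l y\<bar> < K)) (nhds x)"
  proof (intro eventually_conj eventually_ball_finite ballI)
    show "eventually (\<lambda>y. y \<in> U) (nhds x)" using U(1,2) eventually_nhds by blast
    show "eventually (\<lambda>y. \<bar>P i y\<bar> > c) (nhds x)"
      by (rule order_tendstoD(1)[OF tendsto_rabs[OF at] c(2)])
    show "eventually (\<lambda>y. \<bar>P l y\<bar> < K) (nhds x)" for l
      by (rule order_tendstoD(2)[OF tendsto_rabs[OF at] K(2)])
  qed auto
  then obtain s where s: "s > 0" "\<And>y. dist y x < s \<Longrightarrow> y \<in> U \<and> \<bar>P i y\<bar> > c \<and> (\<forall>l. \<bar>P l y\<bar> < K)"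
    unfolding eventually_nhds_metric by blast
  define A where "A = ball x s \<inter> frontier D"
  \<comment> \<open>The summand 1 accounts for the coordinates other than \<open>i\<close>, and
    \<open>K / c\<close> for the \<open>i\<close>-th one, which the others control through the mean
    value theorem.\<close>
  define L where "L = 1 + K / c"
  have L: "L > 0" using K(1) c(1) by (simp add: L_def add_pos_pos)
  have "hausdorff_content (CARD('n) - 1) \<delta> A
    \<le> ennreal (unit_ball_vol (real (CARD('n) - 1)) * (2 * L * real (CARD('n) - 1) * s) ^ (CARD('n) - 1))"
    if "\<delta> > 0" for \<delta>
  proof (rule hausdorff_content_Lipschitz_graph[OF dim s(1) L _ _ that])
    show "\<bar>y $ l - x $ l\<bar> \<le> s" if "y \<in> A" for y l
      using that component_le_norm_cart[of "y - x" l] by (simp add: A_def dist_norm norm_minus_commute)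
    fix y y' assume y: "y \<in> A" "y' \<in> A"
    have U_y: "y \<in> U" "y' \<in> U" using y s(2) by (auto simp: A_def dist_commute)
    have level: "\<rho> y = 0" "\<rho> y' = 0"
      using y U_y frontier_level_zero[OF cl U(1,3,4)] by (auto simp: A_def)
    \<comment> \<open>The segment may leave the frontier, but by convexity it stays in the ball,
      where the bounds on the partial derivatives hold.\<close>
    have seg: "y' + t *\<^sub>R (y - y') \<in> ball x s" if "0 \<le> t" "t \<le> 1" for t
    proof -
      have "(1 - t) *\<^sub>R y' + t *\<^sub>R y \<in> ball x s"
        using y that by (intro convexD[OF convex_ball]) (auto simp: A_def)
      then show ?thesis by (simp add: algebra_simps)
    qed
    have "\<exists>t\<in>{0<..<1}. \<rho> (y' + 1 *\<^sub>R (y - y')) - \<rho> (y' + 0 *\<^sub>R (y - y'))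
        = frechet_derivative \<rho> (at (y' + t *\<^sub>R (y - y'))) ((1 - 0) *\<^sub>R (y - y'))"
    proof (rule mvt_simple[of 0 1 "\<lambda>t. \<rho> (y' + t *\<^sub>R (y - y'))"
          "\<lambda>t h. frechet_derivative \<rho> (at (y' + t *\<^sub>R (y - y'))) (h *\<^sub>R (y - y'))"])
      fix t :: real assume t: "0 \<le> t" "t \<le> 1"
      have "(\<rho> has_derivative frechet_derivative \<rho> (at (y' + t *\<^sub>R (y - y')))) (at (y' + t *\<^sub>R (y - y')))"
        using diff s(2) seg[OF t] frechet_derivative_works by (metis dist_commute mem_ball)
      moreover have "((\<lambda>t. y' + t *\<^sub>R (y - y')) has_derivative (\<lambda>h. h *\<^sub>R (y - y'))) (at t within {0..1})"
        by (auto intro!: derivative_eq_intros)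
      ultimately show "((\<lambda>t. \<rho> (y' + t *\<^sub>R (y - y'))) has_derivative
          (\<lambda>h. frechet_derivative \<rho> (at (y' + t *\<^sub>R (y - y'))) (h *\<^sub>R (y - y')))) (at t within {0..1})"
        by (rule has_derivative_compose[rotated])
    qed simp
    then obtain t where t: "0 < t" "t < 1"
      "frechet_derivative \<rho> (at (y' + t *\<^sub>R (y - y'))) (y - y') = 0"
      using level by auto
    define z where "z = y' + t *\<^sub>R (y - y')"
    have z: "z \<in> U" "\<bar>P i z\<bar> > c" "\<And>l. \<bar>P l z\<bar> < K"
      using seg[of t] t s(2)[of z] by (auto simp: z_def dist_commute)
    let ?S = "\<Sum>l\<in>UNIV - {i}. \<bar>y $ l - y' $ l\<bar>"
    have "0 = (\<Sum>l\<in>UNIV. (y - y') $ l * P l z)"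
      using t(3) frechet_derivative_coordinates[OF diff[OF z(1)], of "y - y'"]
      by (simp add: z_def P_def)
    also have "\<dots> = (y - y') $ i * P i z + (\<Sum>l\<in>UNIV - {i}. (y - y') $ l * P l z)"
      by (rule sum.remove) auto
    finally have "\<bar>(y - y') $ i * P i z\<bar> = \<bar>\<Sum>l\<in>UNIV - {i}. (y - y') $ l * P l z\<bar>" by linarith
    also have "\<dots> \<le> (\<Sum>l\<in>UNIV - {i}. \<bar>(y - y') $ l * P l z\<bar>)" by (rule sum_abs)
    also have "\<dots> \<le> (\<Sum>l\<in>UNIV - {i}. K * \<bar>y $ l - y' $ l\<bar>)"
      using less_imp_le[OF z(3)] by (intro sum_mono) (auto simp: abs_mult mult.commute intro!: mult_right_mono)
    also have "\<dots> = K * ?S" by (simp add: sum_distrib_left)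
    finally have "\<bar>(y - y') $ i\<bar> * \<bar>P i z\<bar> \<le> K * ?S" by (simp add: abs_mult)
    moreover have "\<bar>(y - y') $ i\<bar> * c \<le> \<bar>(y - y') $ i\<bar> * \<bar>P i z\<bar>"
      using z(2) by (intro mult_left_mono) auto
    ultimately have yi: "\<bar>y $ i - y' $ i\<bar> \<le> K / c * ?S"
      using c(1) by (simp add: field_simps)
    have "norm (y - y') \<le> (\<Sum>l\<in>UNIV. \<bar>(y - y') $ l\<bar>)" by (rule norm_le_l1_cart)
    also have "\<dots> = \<bar>y $ i - y' $ i\<bar> + ?S" by (subst sum.remove[of _ i]) auto
    also have "\<dots> \<le> L * ?S" using yi by (simp add: L_def algebra_simps)
    finally show "norm (y - y') \<le> L * ?S" .
  qed
  then have "emeasure (hausdorff_measure (CARD('n) - 1)) A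
    \<le> ennreal (unit_ball_vol (real (CARD('n) - 1)) * (2 * L * real (CARD('n) - 1) * s) ^ (CARD('n) - 1))"
    by (rule emeasure_hausdorff_measure_le)
  also have "\<dots> < \<infinity>" by simp
  finally show ?thesis using s(1) by (intro exI[of _ "ball x s"]) (auto simp: A_def)
qed

lemma finite_boundary_measure:
  fixes D :: "(real^'n) set"
  assumes dim: "CARD('n) \<ge> 2" and D: "smooth_obstacle D"
  shows "finite_measure (boundary_measure D)"
proof -
  let ?H = "hausdorff_measure (CARD('n) - 1) :: (real^'n) measure"
  let ?F = "frontier D"
  obtain W where W: "\<And>x. x \<in> ?F \<Longrightarrow> open (W x) \<and> x \<in> W x \<and> emeasure ?H (W x \<inter> ?F) < \<infinity>"
    using frontier_locally_finite_hausdorff[OF dim D] by metis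
  have "compact ?F" using D by (simp add: smooth_obstacle_def compact_frontier)
  then obtain X where X: "X \<subseteq> ?F" "finite X" "?F \<subseteq> (\<Union>x\<in>X. W x)"
    using W by (elim compactE_image[of ?F ?F W]) blast+
  have "emeasure ?H ?F \<le> emeasure ?H (\<Union>x\<in>X. W x \<inter> ?F)"
  proof (rule emeasure_mono)
    show "?F \<subseteq> (\<Union>x\<in>X. W x \<inter> ?F)" using X(3) by blast
    have "W x \<inter> ?F \<in> sets ?H" if "x \<in> X" for x using that W X(1) by auto
    then show "(\<Union>x\<in>X. W x \<inter> ?F) \<in> sets ?H" by (intro sets.finite_UN X(2))
  qed
  also have "\<dots> \<le> (\<Sum>x\<in>X. emeasure ?H (W x \<inter> ?F))"
    using X(1,2) W by (intro emeasure_subadditive_finite) auto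
  also have "\<dots> < \<infinity>" using X(1,2) W by (auto simp: less_top[symmetric])
  finally show ?thesis
    by (intro finite_measureI) (simp add: boundary_measure_def emeasure_restrict_space space_restrict_space less_top)
qed

section \<open>Regularity of the kernel and of the boundary data\<close>

lemma entire_power_series_C1:
  fixes c :: "nat \<Rightarrow> real"
  assumes "\<And>t. summable (\<lambda>n. c n * t ^ n)"
  obtains f' where "continuous_on UNIV f'" "\<And>t. ((\<lambda>t. \<Sum>n. c n * t ^ n) has_real_derivative f' t) (at t)"
proof
  have s: "summable (\<lambda>n. diffs c n * t ^ n)" for t
    using assms by (rule termdiff_converges_all)
  show "continuous_on UNIV (\<lambda>t. \<Sum>n. diffs c n * t ^ n)"
    using isCont_powser_converges_everywhere[OF s] by (simp add: continuous_on_eq_continuous_at)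
  show "((\<lambda>t. \<Sum>n. c n * t ^ n) has_real_derivative (\<Sum>n. diffs c n * t ^ n)) (at t)" for t
    using assms by (rule termdiffs_strong_converges_everywhere)
qed

text \<open>Serves both Bessel series, which are power series in \<open>t = x^2 / 4\<close> with
  numerators of modulus 1 or \<open>harm n\<close>. Numerators up to \<open>fact n\<close> leave a
  comparison with the exponential series.\<close>

lemma summable_bessel_coeff:
  fixes c :: "nat \<Rightarrow> real"
  assumes "\<And>n. \<bar>c n\<bar> \<le> fact n"
  shows "summable (\<lambda>n. c n / (fact n)\<^sup>2 * t ^ n)"
proof (rule summable_comparison_test[OF _ summable_exp[of "\<bar>t\<bar>"]], intro exI allI impI)
  fix n
  have "\<bar>c n\<bar> / (fact n)\<^sup>2 \<le> fact n / (fact n)\<^sup>2"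
    using assms by (intro divide_right_mono) auto
  also have "\<dots> = inverse (fact n)" by (simp add: power2_eq_square field_simps)
  finally have "\<bar>c n\<bar> / (fact n)\<^sup>2 * \<bar>t\<bar> ^ n \<le> inverse (fact n) * \<bar>t\<bar> ^ n"
    by (rule mult_right_mono) simp
  then show "norm (c n / (fact n)\<^sup>2 * t ^ n) \<le> inverse (fact n) * \<bar>t\<bar> ^ n"
    by (simp add: abs_mult power_abs)
qed

lemma harm_le_fact: "harm n \<le> (fact n :: real)"
proof -
  have "harm n \<le> (\<Sum>k=1..n. 1 :: real)"
    unfolding harm_def by (intro sum_mono) (auto simp: inverse_le_1_iff)
  also have "\<dots> = real n" by simp
  also have "\<dots> \<le> fact n" using fact_ge_self[of n] of_nat_mono[of n "fact n"] by simp
  finally show ?thesis .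
qed

lemma bessel_J0_C1:
  obtains f' where "continuous_on UNIV f'" "\<And>x. (bessel_J0 has_real_derivative f' x) (at x)"
proof -
  let ?f = "\<lambda>t::real. \<Sum>n. (- 1) ^ n / (fact n)\<^sup>2 * t ^ n"
  have "summable (\<lambda>n. (- 1) ^ n / (fact n)\<^sup>2 * t ^ n)" for t :: real
    by (rule summable_bessel_coeff) simp
  then obtain f' where f': "continuous_on UNIV f'" "\<And>t. (?f has_real_derivative f' t) (at t)"
    using entire_power_series_C1[of "\<lambda>n. (- 1) ^ n / (fact n)\<^sup>2"] by blast
  show ?thesis
  proof
    show "continuous_on UNIV (\<lambda>x. f' (x\<^sup>2 / 4) * (x / 2))"
      by (intro continuous_intros continuous_on_compose2[OF f'(1)]) auto
    have eq: "bessel_J0 = (\<lambda>x. ?f (x\<^sup>2 / 4))"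
      unfolding bessel_J0_def by (simp add: fun_eq_iff)
    show "(bessel_J0 has_real_derivative f' (x\<^sup>2 / 4) * (x / 2)) (at x)" for x
      unfolding eq by (rule DERIV_chain2[OF f'(2)]) (auto intro!: derivative_eq_intros)
  qed
qed

lemma bessel_Y0_C1:
  obtains f' where "continuous_on {0<..} f'" "\<And>x. x > 0 \<Longrightarrow> (bessel_Y0 has_real_derivative f' x) (at x)"
proof -
  let ?f = "\<lambda>t::real. \<Sum>n. ((- 1) ^ (n + 1) * harm n) / (fact n)\<^sup>2 * t ^ n"
  have "summable (\<lambda>n. ((- 1) ^ (n + 1) * harm n) / (fact n)\<^sup>2 * t ^ n)" for t :: real
    by (rule summable_bessel_coeff) (use harm_le_fact harm_nonneg in \<open>simp add: abs_mult\<close>)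
  then obtain f' where f': "continuous_on UNIV f'" "\<And>t. (?f has_real_derivative f' t) (at t)"
    using entire_power_series_C1[of "\<lambda>n. ((- 1) ^ (n + 1) * harm n) / (fact n)\<^sup>2"] by blast
  obtain j' where j': "continuous_on UNIV j'" "\<And>x. (bessel_J0 has_real_derivative j' x) (at x)"
    using bessel_J0_C1 by blast
  have cJ: "continuous_on S bessel_J0" for S
    using j'(2) by (meson DERIV_continuous_on has_field_derivative_at_within)
  let ?Y' = "\<lambda>x. 2 / pi * (1 / x * bessel_J0 x + j' x * (ln (x / 2) + euler_mascheroni))
    + 2 / pi * (f' (x\<^sup>2 / 4) * (x / 2))"
  show ?thesis
  proof
    show "continuous_on {0<..} ?Y'"
      by (intro continuous_intros continuous_on_compose2[OF f'(1)]
          continuous_on_subset[OF j'(1)] cJ) auto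
    have eq: "bessel_Y0 = (\<lambda>x. 2 / pi * ((ln (x / 2) + euler_mascheroni) * bessel_J0 x)
      + 2 / pi * ?f (x\<^sup>2 / 4))"
      unfolding bessel_Y0_def by (simp add: fun_eq_iff)
    fix x :: real assume x: "x > 0"
    have 1: "((\<lambda>x. ?f (x\<^sup>2 / 4)) has_real_derivative f' (x\<^sup>2 / 4) * (x / 2)) (at x)"
      by (rule DERIV_chain2[OF f'(2)]) (auto intro!: derivative_eq_intros)
    have 2: "((\<lambda>x. ln (x / 2) + euler_mascheroni) has_real_derivative 1 / x) (at x)"
      using x by (auto intro!: derivative_eq_intros)
    show "(bessel_Y0 has_real_derivative ?Y' x) (at x)"
      unfolding eq by (intro DERIV_add DERIV_cmult 1 DERIV_mult[OF 2 j'(2), THEN DERIV_cong]) simp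
  qed
qed

lemma hankel_H0_C1:
  obtains h' where "continuous_on {0<..} h'"
    "\<And>x. x > 0 \<Longrightarrow> (hankel_H0 has_vector_derivative h' x) (at x)"
proof -
  obtain j' where j': "continuous_on UNIV j'" "\<And>x. (bessel_J0 has_real_derivative j' x) (at x)"
    using bessel_J0_C1 by blast
  obtain y' where y': "continuous_on {0<..} y'" "\<And>x. x > 0 \<Longrightarrow> (bessel_Y0 has_real_derivative y' x) (at x)"
    using bessel_Y0_C1 by blast
  show ?thesis
  proof
    show "continuous_on {0<..} (\<lambda>x. complex_of_real (j' x) + \<i> * complex_of_real (y' x))"
      by (intro continuous_intros y'(1) continuous_on_subset[OF j'(1)]) auto
    fix x :: real assume x: "x > 0"
    show "(hankel_H0 has_vector_derivative complex_of_real (j' x) + \<i> * complex_of_real (y' x)) (at x)"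
      unfolding hankel_H0_def
      by (intro has_vector_derivative_add has_vector_derivative_mult_right has_vector_derivative_of_real
          j'(2) y'(2)[OF x])
  qed
qed

text \<open>Hides the dimension: from here on the kernel is only a radial profile that is
  continuously differentiable away from 0.\<close>

lemma green_G_radial:
  assumes "k > 0"
  obtains \<phi> \<phi>' :: "real \<Rightarrow> complex" where
    "continuous_on {0<..} \<phi>'" "\<And>r. r > 0 \<Longrightarrow> (\<phi> has_vector_derivative \<phi>' r) (at r)"
    "\<And>x y :: real^'n. green_G k x y = \<phi> (norm (x - y))"
proof (cases "CARD('n) = 2")
  case True
  obtain h' where h': "continuous_on {0<..} h'"
    "\<And>x. x > 0 \<Longrightarrow> (hankel_H0 has_vector_derivative h' x) (at x)"
    using hankel_H0_C1 by blast
  show ?thesis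
  proof
    show "continuous_on {0<..} (\<lambda>r. - 2 * (\<i> / 4 * (k *\<^sub>R h' (k * r))))"
      using assms by (intro continuous_intros continuous_on_compose2[OF h'(1)]) auto
    fix r :: real assume r: "r > 0"
    have "((\<lambda>r. hankel_H0 (k * r)) has_vector_derivative k *\<^sub>R h' (k * r)) (at r)"
      using vector_diff_chain_at[of "\<lambda>r. k * r" k r hankel_H0 "h' (k * r)"] h'(2)[of "k * r"] assms r
      by (auto simp: o_def has_real_derivative_iff_has_vector_derivative[symmetric]
          intro!: derivative_eq_intros)
    then show "((\<lambda>r. - 2 * (\<i> / 4 * hankel_H0 (k * r))) has_vector_derivative
        - 2 * (\<i> / 4 * (k *\<^sub>R h' (k * r)))) (at r)"
      by (intro has_vector_derivative_mult_right)
  next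
    show "green_G k x y = - 2 * (\<i> / 4 * hankel_H0 (k * norm (x - y)))" for x y :: "real^'n"
      unfolding green_G_def fundamental_solution_def using True by simp
  qed
next
  case False
  \<comment> \<open>The profile is written with a complex argument so that it can be differentiated
    as a complex function and then restricted to the real axis.\<close>
  let ?e = "\<lambda>z::complex. - 2 * (1 / (4 * complex_of_real pi) * (exp (\<i> * (complex_of_real k * z)) / z))"
  let ?e' = "\<lambda>z::complex. - 2 * (1 / (4 * complex_of_real pi) *
    ((exp (\<i> * (complex_of_real k * z)) * (\<i> * complex_of_real k) * z - exp (\<i> * (complex_of_real k * z))) / (z * z)))"
  show ?thesis
  proof
    show "continuous_on {0<..} (\<lambda>r. ?e' (complex_of_real r))"
      by (intro continuous_intros) auto
    fix r :: real assume r: "r > 0"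
    have "(?e has_field_derivative ?e' (complex_of_real r)) (at (complex_of_real r))"
      using r by (intro DERIV_cmult) (auto intro!: derivative_eq_intros)
    then show "((\<lambda>r. ?e (complex_of_real r)) has_vector_derivative ?e' (complex_of_real r)) (at r)"
      by (rule has_vector_derivative_real_field)
  next
    show "green_G k x y = ?e (complex_of_real (norm (x - y)))" for x y :: "real^'n"
      unfolding green_G_def fundamental_solution_def using False by simp
  qed
qed

text \<open>Disjointness keeps \<open>norm (x - y)\<close> positive, where the profile is smooth
  enough. The chain rule, with \<open>sgn (x - y)\<close> as gradient of the norm, gives a formula
  that is jointly continuous in both points.\<close>

lemma continuous_on_impedance_green_G:
  fixes F F' :: "(real^'n) set"
  assumes k: "k > 0" and disj: "F \<inter> F' = {}" and \<nu>: "continuous_on F \<nu>"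
  shows "continuous_on (F \<times> F') (\<lambda>z. impedance k (\<lambda>u. green_G k u (snd z)) (fst z) (\<nu> (fst z)))"
proof -
  obtain \<phi> \<phi>' where \<phi>: "continuous_on {0<..} \<phi>'"
    "\<And>r. r > 0 \<Longrightarrow> (\<phi> has_vector_derivative \<phi>' r) (at r)"
    "\<And>x y :: real^'n. green_G k x y = \<phi> (norm (x - y))"
    by (rule green_G_radial[OF k, where ?'n = 'n], rule that)
  have c\<phi>: "continuous_on {0<..} \<phi>"
    using \<phi>(2) by (intro continuous_at_imp_continuous_on) (auto intro: has_vector_derivative_continuous)
  have "impedance k (\<lambda>u. green_G k u y) x w
      = (w \<bullet> sgn (x - y)) *\<^sub>R \<phi>' (norm (x - y)) + \<i> * complex_of_real k * \<phi> (norm (x - y))"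
    if "x \<noteq> y" for x y w :: "real^'n"
  proof -
    have "((\<lambda>u. norm (u - y)) has_derivative (\<lambda>h. h \<bullet> sgn (x - y))) (at x)"
      using that
      by (intro has_derivative_compose[of "\<lambda>u. u - y" "\<lambda>h. h" x UNIV norm] has_derivative_norm)
        (auto intro!: derivative_eq_intros)
    moreover have "(\<phi> has_derivative (\<lambda>h. h *\<^sub>R \<phi>' (norm (x - y)))) (at (norm (x - y)))"
      using \<phi>(2)[of "norm (x - y)"] that by (simp add: has_vector_derivative_def)
    ultimately have "((\<lambda>u. \<phi> (norm (u - y))) has_derivative
        (\<lambda>h. (h \<bullet> sgn (x - y)) *\<^sub>R \<phi>' (norm (x - y)))) (at x)"
      by (rule has_derivative_compose)
    then show ?thesis
      unfolding impedance_def \<phi>(3) by (simp add: frechet_derivative_at[symmetric])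
  qed
  note val = this
  have eq: "impedance k (\<lambda>u. green_G k u (snd z)) (fst z) (\<nu> (fst z))
      = (\<nu> (fst z) \<bullet> sgn (fst z - snd z)) *\<^sub>R \<phi>' (norm (fst z - snd z))
        + \<i> * complex_of_real k * \<phi> (norm (fst z - snd z))" if "z \<in> F \<times> F'" for z
    by (rule val) (use that disj in auto)
  have "continuous_on (F \<times> F') (\<lambda>z. (\<nu> (fst z) \<bullet> sgn (fst z - snd z)) *\<^sub>R \<phi>' (norm (fst z - snd z))
        + \<i> * complex_of_real k * \<phi> (norm (fst z - snd z)))"
    using disj by (intro continuous_intros continuous_on_compose2[OF \<phi>(1)] continuous_on_compose2[OF c\<phi>]
        continuous_on_compose2[OF \<nu>]) auto
  then show ?thesis using eq by (simp cong: continuous_on_cong)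
qed

text \<open>The direction of differentiation varies with the point; expanding along the axes
  separates the normal from the partial derivatives of \<open>u\<close>, and both are
  continuous.\<close>

lemma continuous_on_boundary_data:
  assumes u: "helmholtz_solution k u" and \<nu>: "continuous_on F (exterior_normal (scatterer J \<Omega>))"
  shows "continuous_on F (boundary_data k J \<Omega> u)"
proof -
  have C2: "Ck_on (Suc (Suc 0)) UNIV u" using u by (simp add: helmholtz_solution_def numeral_2_eq_2)
  then have diff: "u differentiable (at x)" for x by simp
  have cu: "continuous_on F u"
    using diff by (intro continuous_at_imp_continuous_on) (auto intro: differentiable_imp_continuous_within)
  have cP: "continuous_on F (\<lambda>x. frechet_derivative u (at x) (axis l 1))" for l
    using continuous_on_frechet_derivative_axis[OF C2] by (rule continuous_on_subset) simp
  have "continuous_on F (\<lambda>x. \<Sum>l\<in>UNIV. (exterior_normal (scatterer J \<Omega>) x $ l) *\<^sub>R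
      frechet_derivative u (at x) (axis l 1))"
    by (intro continuous_intros cP \<nu>)
  then have "continuous_on F (\<lambda>x. frechet_derivative u (at x) (exterior_normal (scatterer J \<Omega>) x))"
    by (subst frechet_derivative_coordinates[OF diff])
  then show ?thesis unfolding boundary_data_def impedance_def by (intro continuous_intros cu)
qed

section \<open>Operators on square integrable functions\<close>

lemma l2_space_add:
  assumes "f \<in> l2_space M" "g \<in> l2_space M"
  shows "(\<lambda>x. f x + g x) \<in> l2_space M"
proof -
  have [measurable]: "f \<in> borel_measurable M" "g \<in> borel_measurable M"
    using assms by (auto simp: l2_space_def)
  have "integrable M (\<lambda>x. (cmod (f x + g x))\<^sup>2)"
  proof (rule Bochner_Integration.integrable_bound)
    show "integrable M (\<lambda>x. 2 * (cmod (f x))\<^sup>2 + 2 * (cmod (g x))\<^sup>2)"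
      using assms by (auto simp: l2_space_def)
    have "(cmod (f x + g x))\<^sup>2 \<le> 2 * (cmod (f x))\<^sup>2 + 2 * (cmod (g x))\<^sup>2" for x
    proof -
      have "(cmod (f x + g x))\<^sup>2 \<le> (cmod (f x) + cmod (g x))\<^sup>2"
        by (intro power_mono norm_triangle_ineq) auto
      also have "\<dots> \<le> 2 * (cmod (f x))\<^sup>2 + 2 * (cmod (g x))\<^sup>2"
        using sum_squares_bound[of "cmod (f x)" "cmod (g x)"] by (simp add: power2_sum)
      finally show ?thesis .
    qed
    then show "AE x in M. norm ((cmod (f x + g x))\<^sup>2) \<le> norm (2 * (cmod (f x))\<^sup>2 + 2 * (cmod (g x))\<^sup>2)"
      by (intro AE_I2) (simp add: order_trans[OF _ abs_ge_self])
  qed measurable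
  then show ?thesis by (simp add: l2_space_def)
qed

lemma l2_space_cmult:
  assumes "f \<in> l2_space M"
  shows "(\<lambda>x. c * f x) \<in> l2_space M"
  using assms by (auto simp: l2_space_def norm_mult power_mult_distrib)

lemma l2_space_zero: "(\<lambda>x. 0) \<in> l2_space M"
  by (simp add: l2_space_def)

lemma l2_space_sum:
  assumes "finite I" "\<And>i. i \<in> I \<Longrightarrow> f i \<in> l2_space M"
  shows "(\<lambda>x. \<Sum>i\<in>I. f i x) \<in> l2_space M"
  using assms by (induction I rule: finite_induct) (auto intro: l2_space_zero l2_space_add)

lemma l2_space_lincomb:
  assumes "finite I" "\<And>i. i \<in> I \<Longrightarrow> f i \<in> l2_space M"
  shows "(\<lambda>x. \<Sum>i\<in>I. c i * f i x) \<in> l2_space M"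
  using assms by (intro l2_space_sum l2_space_cmult) auto

lemma (in finite_measure) l2_space_bounded:
  assumes "f \<in> borel_measurable M" "\<And>x. x \<in> space M \<Longrightarrow> cmod (f x) \<le> B"
  shows "f \<in> l2_space M"
proof -
  have "integrable M (\<lambda>x. (cmod (f x))\<^sup>2)"
    by (rule integrable_const_bound[of _ "B\<^sup>2"]) (use assms in \<open>auto intro!: power_mono\<close>)
  then show ?thesis using assms(1) by (simp add: l2_space_def)
qed

lemma (in finite_measure) l2_space_integrable:
  assumes "f \<in> l2_space M"
  shows "integrable M f"
proof (rule Bochner_Integration.integrable_bound)
  show "integrable M (\<lambda>x. 1 + (cmod (f x))\<^sup>2)" using assms by (auto simp: l2_space_def)
  show "f \<in> borel_measurable M" using assms by (auto simp: l2_space_def)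
  have "cmod (f x) \<le> 1 + (cmod (f x))\<^sup>2" for x
    using sum_squares_bound[of 1 "cmod (f x)"] norm_ge_zero[of "f x"] unfolding power_one mult_1_right
    by linarith
  then show "AE x in M. norm (f x) \<le> norm (1 + (cmod (f x))\<^sup>2)"
    by (intro AE_I2) (simp add: order_trans[OF _ abs_ge_self])
qed

lemma ae_eq_refl: "ae_eq M f f"
  by (simp add: ae_eq_def)

lemma ae_eq_sym: "ae_eq M f g \<Longrightarrow> ae_eq M g f"
  unfolding ae_eq_def by (auto elim: eventually_mono)

lemma ae_eq_trans [trans]: "ae_eq M f g \<Longrightarrow> ae_eq M g h \<Longrightarrow> ae_eq M f h"
  unfolding ae_eq_def by (auto elim: eventually_elim2)

lemma ae_eq_add: "ae_eq M f g \<Longrightarrow> ae_eq M f' g' \<Longrightarrow> ae_eq M (\<lambda>x. f x + f' x) (\<lambda>x. g x + g' x)"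
  unfolding ae_eq_def by (auto elim: eventually_elim2)

lemma ae_eq_diff: "ae_eq M f g \<Longrightarrow> ae_eq M f' g' \<Longrightarrow> ae_eq M (\<lambda>x. f x - f' x) (\<lambda>x. g x - g' x)"
  unfolding ae_eq_def by (auto elim: eventually_elim2)

lemma ae_eq_cmult: "ae_eq M f g \<Longrightarrow> ae_eq M (\<lambda>x. c * f x) (\<lambda>x. c * g x)"
  unfolding ae_eq_def by (auto elim: eventually_mono)

lemma ae_eq_sum:
  assumes "finite I" "\<And>i. i \<in> I \<Longrightarrow> ae_eq M (f i) (g i)"
  shows "ae_eq M (\<lambda>x. \<Sum>i\<in>I. f i x) (\<lambda>x. \<Sum>i\<in>I. g i x)"
  using assms by (induction I rule: finite_induct) (auto intro: ae_eq_refl ae_eq_add)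

section \<open>Linear operators and their inverses modulo null sets\<close>

lemma bounded_l2_operatorD:
  assumes "bounded_l2_operator M A" "f \<in> l2_space M"
  shows bounded_l2_operator_closed: "A f \<in> l2_space M"
    and bounded_l2_operator_add: "g \<in> l2_space M \<Longrightarrow> ae_eq M (A (\<lambda>x. f x + g x)) (\<lambda>x. A f x + A g x)"
    and bounded_l2_operator_cmult: "ae_eq M (A (\<lambda>x. c * f x)) (\<lambda>x. c * A f x)"
  using assms unfolding bounded_l2_operator_def by simp_all

lemma bounded_l2_operator_lincomb:
  assumes "bounded_l2_operator M A" "finite I" "\<And>i. i \<in> I \<Longrightarrow> f i \<in> l2_space M"
  shows "ae_eq M (A (\<lambda>x. \<Sum>i\<in>I. c i * f i x)) (\<lambda>x. \<Sum>i\<in>I. c i * A (f i) x)"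
  using assms(2,3)
proof (induction I rule: finite_induct)
  case empty
  \<comment> \<open>Homogeneity with factor 0 determines the value of \<open>A\<close> at the zero
    function.\<close>
  have "ae_eq M (A (\<lambda>x. 0 * (0::complex))) (\<lambda>x. 0 * A (\<lambda>x. 0) x)"
    using bounded_l2_operator_cmult[OF assms(1) l2_space_zero] .
  then show ?case by simp
next
  case (insert i I)
  have f: "(\<lambda>x. c i * f i x) \<in> l2_space M" "(\<lambda>x. \<Sum>i\<in>I. c i * f i x) \<in> l2_space M"
    using insert by (auto intro: l2_space_cmult l2_space_lincomb)
  have "ae_eq M (A (\<lambda>x. c i * f i x + (\<Sum>i\<in>I. c i * f i x)))
      (\<lambda>x. A (\<lambda>x. c i * f i x) x + A (\<lambda>x. \<Sum>i\<in>I. c i * f i x) x)"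
    using bounded_l2_operator_add[OF assms(1) f] .
  also have "ae_eq M \<dots> (\<lambda>x. c i * A (f i) x + (\<Sum>i\<in>I. c i * A (f i) x))"
  proof (rule ae_eq_add)
    show "ae_eq M (A (\<lambda>x. c i * f i x)) (\<lambda>x. c i * A (f i) x)"
      using insert by (intro bounded_l2_operator_cmult[OF assms(1)]) simp
    show "ae_eq M (A (\<lambda>x. \<Sum>i\<in>I. c i * f i x)) (\<lambda>x. \<Sum>i\<in>I. c i * A (f i) x)"
      using insert by simp
  qed
  finally show ?case using insert by simp
qed

text \<open>The difference \<open>h\<close> has norm 0, so the norm bound forces \<open>A h\<close>
  to vanish almost everywhere; additivity and homogeneity split it into the two values.\<close>

lemma bounded_l2_operator_ae_cong:
  assumes "bounded_l2_operator M A" "f \<in> l2_space M" "g \<in> l2_space M" "ae_eq M f g"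
  shows "ae_eq M (A f) (A g)"
proof -
  obtain C where C: "\<And>h. h \<in> l2_space M \<Longrightarrow> l2_norm M (A h) \<le> C * l2_norm M h"
    using assms(1) unfolding bounded_l2_operator_def by blast
  define h where "h = (\<lambda>x. f x + (- 1) * g x)"
  have g': "(\<lambda>x. (- 1) * g x) \<in> l2_space M" using assms(3) by (rule l2_space_cmult)
  have h: "h \<in> l2_space M" unfolding h_def using assms(2) g' by (rule l2_space_add)
  have Ah: "A h \<in> l2_space M" by (rule bounded_l2_operator_closed[OF assms(1) h])
  have "(\<integral>x. (cmod (h x))\<^sup>2 \<partial>M) = 0"
    using assms(4) by (intro integral_eq_zero_AE) (auto simp: ae_eq_def h_def elim: eventually_mono)
  then have "l2_norm M h = 0" by (simp add: l2_norm_def)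
  then have "l2_norm M (A h) \<le> 0" using C[OF h] by simp
  then have "(\<integral>x. (cmod (A h x))\<^sup>2 \<partial>M) = 0"
    by (intro antisym Bochner_Integration.integral_nonneg) (auto simp: l2_norm_def)
  then have "AE x in M. (cmod (A h x))\<^sup>2 = 0"
    using Ah by (subst integral_nonneg_eq_0_iff_AE[symmetric]) (auto simp: l2_space_def)
  then have "ae_eq M (\<lambda>x. 0) (A h)"
    unfolding ae_eq_def by (auto elim: eventually_mono)
  also have "ae_eq M (A h) (\<lambda>x. A f x + A (\<lambda>x. (- 1) * g x) x)"
    unfolding h_def by (rule bounded_l2_operator_add[OF assms(1,2) g'])
  also have "ae_eq M \<dots> (\<lambda>x. A f x + (- 1) * A g x)"
    by (intro ae_eq_add ae_eq_refl bounded_l2_operator_cmult[OF assms(1,3)])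
  finally show ?thesis unfolding ae_eq_def by (auto elim: eventually_mono)
qed

lemma boundedly_invertible_inject:
  assumes "boundedly_invertible M A" "f \<in> l2_space M" "g \<in> l2_space M" "ae_eq M (A f) (A g)"
  shows "ae_eq M f g"
proof -
  obtain B where B: "bounded_l2_operator M B" "\<And>f. f \<in> l2_space M \<Longrightarrow> ae_eq M (B (A f)) f"
    using assms(1) unfolding boundedly_invertible_def by blast
  have A: "bounded_l2_operator M A" using assms(1) by (simp add: boundedly_invertible_def)
  have "ae_eq M f (B (A f))" using B(2)[OF assms(2)] by (rule ae_eq_sym)
  also have "ae_eq M \<dots> (B (A g))"
    by (rule bounded_l2_operator_ae_cong[OF B(1) bounded_l2_operator_closed[OF A assms(2)]
        bounded_l2_operator_closed[OF A assms(3)] assms(4)])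
  also have "ae_eq M \<dots> g" by (rule B(2)[OF assms(3)])
  finally show ?thesis .
qed

lemma l2_inverse:
  assumes "boundedly_invertible M A" "f \<in> l2_space M"
  shows l2_inverse_in_l2_space: "l2_inverse M A f \<in> l2_space M"
    and ae_eq_l2_inverse: "ae_eq M (A (l2_inverse M A f)) f"
proof -
  have "\<exists>\<mu>. \<mu> \<in> l2_space M \<and> ae_eq M (A \<mu>) f"
    using assms unfolding boundedly_invertible_def bounded_l2_operator_def by blast
  from someI_ex[OF this] show "l2_inverse M A f \<in> l2_space M" "ae_eq M (A (l2_inverse M A f)) f"
    by (auto simp: l2_inverse_def)
qed

text \<open>The choices made on the two sides are unrelated. After applying \<open>A\<close> both
  produce the same data almost everywhere, and injectivity takes this back.\<close>

lemma l2_inverse_lincomb: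
  assumes A: "boundedly_invertible M A" and I: "finite I" and f: "\<And>i. i \<in> I \<Longrightarrow> f i \<in> l2_space M"
  shows "ae_eq M (l2_inverse M A (\<lambda>x. \<Sum>i\<in>I. c i * f i x)) (\<lambda>x. \<Sum>i\<in>I. c i * l2_inverse M A (f i) x)"
proof (rule boundedly_invertible_inject[OF A])
  have A': "bounded_l2_operator M A" using A by (simp add: boundedly_invertible_def)
  note inv = l2_inverse_in_l2_space[OF A f]
  have lc: "(\<lambda>x. \<Sum>i\<in>I. c i * f i x) \<in> l2_space M" using I f by (rule l2_space_lincomb)
  show "l2_inverse M A (\<lambda>x. \<Sum>i\<in>I. c i * f i x) \<in> l2_space M"
    using A lc by (rule l2_inverse_in_l2_space)
  show "(\<lambda>x. \<Sum>i\<in>I. c i * l2_inverse M A (f i) x) \<in> l2_space M"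
    using I inv by (rule l2_space_lincomb)
  have "ae_eq M (A (l2_inverse M A (\<lambda>x. \<Sum>i\<in>I. c i * f i x))) (\<lambda>x. \<Sum>i\<in>I. c i * f i x)"
    using A lc by (rule ae_eq_l2_inverse)
  also have "ae_eq M \<dots> (\<lambda>x. \<Sum>i\<in>I. c i * A (l2_inverse M A (f i)) x)"
    by (intro ae_eq_sum[OF I] ae_eq_cmult ae_eq_sym[OF ae_eq_l2_inverse[OF A f]])
  also have "ae_eq M \<dots> (A (\<lambda>x. \<Sum>i\<in>I. c i * l2_inverse M A (f i) x))"
    using inv by (intro ae_eq_sym[OF bounded_l2_operator_lincomb[OF A' I]])
  finally show "ae_eq M (A (l2_inverse M A (\<lambda>x. \<Sum>i\<in>I. c i * f i x)))
    (A (\<lambda>x. \<Sum>i\<in>I. c i * l2_inverse M A (f i) x))" .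
qed

lemma integrable_bounded_mult_l2:
  assumes F: "finite_measure N" and \<mu>: "\<mu> \<in> l2_space N"
    and K: "K \<in> borel_measurable N" "\<And>y. y \<in> space N \<Longrightarrow> cmod (K y) \<le> B"
  shows "integrable N (\<lambda>y. K y * \<mu> y)"
proof (rule Bochner_Integration.integrable_bound)
  have int: "integrable N \<mu>" using finite_measure.l2_space_integrable[OF F \<mu>] .
  then show "integrable N (\<lambda>y. B * cmod (\<mu> y))" by simp
  show "(\<lambda>y. K y * \<mu> y) \<in> borel_measurable N" using K(1) int by auto
  show "AE y in N. norm (K y * \<mu> y) \<le> norm (B * cmod (\<mu> y))"
    using K(2) by (intro AE_I2) (auto simp: norm_mult abs_mult intro!: mult_right_mono order_trans[OF _ abs_ge_self])
qed

section \<open>The multiple scattering operator\<close>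

text \<open>The interaction of two different sub-scatterers
  has a continuous kernel, whereas nothing but invertibility is known about \<open>S_op k J \<Omega> j j\<close>.\<close>

locale multiple_scatterer =
  fixes k :: real and J :: nat and \<Omega> :: "nat \<Rightarrow> (real^'n) set"
  assumes dim: "CARD('n) \<ge> 2"
    and k_pos: "k > 0"
    and obstacles: "\<And>j. j \<in> {1..J} \<Longrightarrow> smooth_obstacle (\<Omega> j)"
    and J_pos: "J \<ge> 1"
    and disjoint: "\<And>i j. i \<in> {1..J} \<Longrightarrow> j \<in> {1..J} \<Longrightarrow> i \<noteq> j \<Longrightarrow> \<Omega> i \<inter> \<Omega> j = {}"
    and invertible: "\<And>j. j \<in> {1..J} \<Longrightarrow>
      boundedly_invertible (boundary_measure (\<Omega> j)) (one_minus (S_op k J \<Omega> j j))"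
begin

abbreviation "N j \<equiv> boundary_measure (\<Omega> j)"
abbreviation "M \<equiv> boundary_measure (scatterer J \<Omega>)"

section \<open>Geometry of the union and its boundary measures\<close>

lemma compact_\<Omega>: "j \<in> {1..J} \<Longrightarrow> compact (\<Omega> j)"
  using obstacles by (simp add: smooth_obstacle_def)

lemma frontier_subset_\<Omega>: "j \<in> {1..J} \<Longrightarrow> frontier (\<Omega> j) \<subseteq> \<Omega> j"
  using compact_\<Omega> by (simp add: compact_imp_closed frontier_subset_closed)

lemma frontier_disjoint:
  "i \<in> {1..J} \<Longrightarrow> j \<in> {1..J} \<Longrightarrow> i \<noteq> j \<Longrightarrow> frontier (\<Omega> i) \<inter> frontier (\<Omega> j) = {}"
  using disjoint frontier_subset_\<Omega> by blast

text \<open>The other sub-scatterers form a finite union of compact sets, so their complement is an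
  open set on which only \<open>\<Omega> j\<close> remains.\<close>

lemma scatterer_locally:
  assumes "j \<in> {1..J}" "x \<in> \<Omega> j"
  obtains V where "open V" "x \<in> V" "\<Omega> j \<inter> V = scatterer J \<Omega> \<inter> V"
proof
  let ?V = "- (\<Union>i\<in>{1..J} - {j}. \<Omega> i)"
  show "open ?V" using compact_\<Omega> by (intro open_Compl closed_UN) (auto intro: compact_imp_closed)
  show "x \<in> ?V" using assms disjoint by blast
  show "\<Omega> j \<inter> ?V = scatterer J \<Omega> \<inter> ?V" using assms unfolding scatterer_def by blast
qed

lemma compact_scatterer: "compact (scatterer J \<Omega>)"
  unfolding scatterer_def using compact_\<Omega> by (intro compact_UN) auto

lemma frontier_scatterer: "frontier (scatterer J \<Omega>) = (\<Union>j\<in>{1..J}. frontier (\<Omega> j))"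
proof (intro subset_antisym subsetI)
  fix x assume x: "x \<in> frontier (scatterer J \<Omega>)"
  then have "x \<in> scatterer J \<Omega>"
    using compact_scatterer frontier_subset_closed compact_imp_closed by blast
  then obtain j where j: "j \<in> {1..J}" "x \<in> \<Omega> j" by (auto simp: scatterer_def)
  obtain V where "open V" "x \<in> V" "\<Omega> j \<inter> V = scatterer J \<Omega> \<inter> V" using scatterer_locally[OF j] .
  from frontier_cong_open[OF this] show "x \<in> (\<Union>j\<in>{1..J}. frontier (\<Omega> j))" using x j(1) by blast
next
  fix x assume "x \<in> (\<Union>j\<in>{1..J}. frontier (\<Omega> j))"
  then obtain j where j: "j \<in> {1..J}" "x \<in> frontier (\<Omega> j)" by blast
  obtain V where "open V" "x \<in> V" "\<Omega> j \<inter> V = scatterer J \<Omega> \<inter> V"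
    using scatterer_locally[OF j(1)] j frontier_subset_\<Omega> by blast
  from frontier_cong_open[OF this] show "x \<in> frontier (scatterer J \<Omega>)" using j(2) by blast
qed

text \<open>\<open>S_op\<close> and \<open>boundary_data\<close> use the normal of the union, so
  continuity of normals has to be applied to the union itself.\<close>

lemma smooth_obstacle_scatterer: "smooth_obstacle (scatterer J \<Omega>)"
  unfolding smooth_obstacle_def
proof (intro conjI ballI)
  show "compact (scatterer J \<Omega>)" by (rule compact_scatterer)
  have "\<Omega> 1 \<noteq> {}" "1 \<in> {1..J}" using obstacles[of 1] J_pos by (auto simp: smooth_obstacle_def)
  then show "scatterer J \<Omega> \<noteq> {}" unfolding scatterer_def by blast
  fix x assume "x \<in> frontier (scatterer J \<Omega>)"
  then obtain j where j: "j \<in> {1..J}" "x \<in> frontier (\<Omega> j)" by (auto simp: frontier_scatterer)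
  obtain V where V: "open V" "x \<in> V" "\<Omega> j \<inter> V = scatterer J \<Omega> \<inter> V"
    using scatterer_locally[OF j(1)] j frontier_subset_\<Omega> by blast
  obtain v where "boundary_gradient (\<Omega> j) x v"
    using obstacles[OF j(1)] j(2) by (auto simp: smooth_obstacle_def)
  from boundary_gradient_cong_open[OF V this] show "\<exists>v. boundary_gradient (scatterer J \<Omega>) x v" ..
qed

lemma continuous_on_normal:
  assumes "j \<in> {1..J}"
  shows "continuous_on (frontier (\<Omega> j)) (exterior_normal (scatterer J \<Omega>))"
  using continuous_on_exterior_normal[OF smooth_obstacle_scatterer]
  by (rule continuous_on_subset) (use assms frontier_scatterer in blast)

lemma space_N: "space (N j) = frontier (\<Omega> j)"
  by (simp add: boundary_measure_def space_restrict_space)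

lemma finite_measure_N: "j \<in> {1..J} \<Longrightarrow> finite_measure (N j)"
  using finite_boundary_measure[OF dim] obstacles by blast

lemma borel_measurable_N:
  assumes "continuous_on (frontier (\<Omega> j)) f"
  shows "f \<in> borel_measurable (N j)"
  using borel_measurable_continuous_on_restrict[OF assms]
  by (simp add: boundary_measure_def measurable_def sets_restrict_space space_restrict_space)

lemma continuous_on_l2_space:
  assumes "j \<in> {1..J}" "continuous_on (frontier (\<Omega> j)) f"
  shows "f \<in> l2_space (N j)"
proof -
  have "bounded (f ` frontier (\<Omega> j))"
    using assms compact_\<Omega>
    by (intro compact_imp_bounded compact_continuous_image compact_frontier) auto
  then obtain B where "\<forall>w \<in> f ` frontier (\<Omega> j). cmod w \<le> B"
    unfolding bounded_iff ..
  then show ?thesis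
    using finite_measure.l2_space_bounded[OF finite_measure_N[OF assms(1)] borel_measurable_N[OF assms(2)], of B]
    by (simp add: space_N)
qed

section \<open>Interaction of two different sub-scatterers\<close>

abbreviation "kern x y \<equiv> impedance k (\<lambda>z. green_G k z y) x (exterior_normal (scatterer J \<Omega>) x)"

lemma kernel_bounded:
  assumes "i \<in> {1..J}" "j \<in> {1..J}" "i \<noteq> j"
  shows "continuous_on (frontier (\<Omega> i) \<times> frontier (\<Omega> j)) (\<lambda>z. kern (fst z) (snd z))"
    and "\<exists>B. \<forall>x\<in>frontier (\<Omega> i). \<forall>y\<in>frontier (\<Omega> j). cmod (kern x y) \<le> B"
proof -
  show cont: "continuous_on (frontier (\<Omega> i) \<times> frontier (\<Omega> j)) (\<lambda>z. kern (fst z) (snd z))"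
    using continuous_on_impedance_green_G[OF k_pos frontier_disjoint[OF assms] continuous_on_normal[OF assms(1)]] .
  have "bounded ((\<lambda>z. kern (fst z) (snd z)) ` (frontier (\<Omega> i) \<times> frontier (\<Omega> j)))"
    using compact_\<Omega> assms
    by (intro compact_imp_bounded compact_continuous_image cont compact_Times compact_frontier) auto
  then obtain B where B: "\<forall>w \<in> (\<lambda>z. kern (fst z) (snd z)) ` (frontier (\<Omega> i) \<times> frontier (\<Omega> j)). cmod w \<le> B"
    unfolding bounded_iff ..
  have "cmod (kern x y) \<le> B" if "x \<in> frontier (\<Omega> i)" "y \<in> frontier (\<Omega> j)" for x y
    using bspec[OF B imageI[of "(x, y)"]] that by simp
  then show "\<exists>B. \<forall>x\<in>frontier (\<Omega> i). \<forall>y\<in>frontier (\<Omega> j). cmod (kern x y) \<le> B" by blast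
qed

lemma kernel_measurable:
  assumes "i \<in> {1..J}" "j \<in> {1..J}" "i \<noteq> j" "x \<in> frontier (\<Omega> i)"
  shows "(\<lambda>y. kern x y) \<in> borel_measurable (N j)"
proof (rule borel_measurable_N)
  show "continuous_on (frontier (\<Omega> j)) (\<lambda>y. kern x y)"
    using continuous_on_compose2[OF kernel_bounded(1)[OF assms(1-3)], of "frontier (\<Omega> j)" "\<lambda>y. (x, y)"] assms(4)
    by (simp add: continuous_on_Pair image_subset_iff)
qed

lemma kernel_integrable:
  assumes "i \<in> {1..J}" "j \<in> {1..J}" "i \<noteq> j" "x \<in> frontier (\<Omega> i)" "\<mu> \<in> l2_space (N j)"
  shows "integrable (N j) (\<lambda>y. kern x y * \<mu> y)"
proof -
  obtain B where "\<forall>x\<in>frontier (\<Omega> i). \<forall>y\<in>frontier (\<Omega> j). cmod (kern x y) \<le> B"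
    using kernel_bounded(2)[OF assms(1-3)] by blast
  then show ?thesis
    using assms by (intro integrable_bounded_mult_l2[of _ _ _ B] finite_measure_N
        kernel_measurable[of i]) (auto simp: space_N)
qed

text \<open>The image is even continuous on \<open>frontier (\<Omega> i)\<close>. Dominated
  convergence applies with majorant \<open>B * cmod (\<mu> y)\<close>, which is integrable because
  square integrable functions are integrable on a finite measure space.\<close>

lemma S_op_l2_space:
  assumes ij: "i \<in> {1..J}" "j \<in> {1..J}" "i \<noteq> j" and \<mu>: "\<mu> \<in> l2_space (N j)"
  shows "S_op k J \<Omega> i j \<mu> \<in> l2_space (N i)"
proof (rule continuous_on_l2_space[OF ij(1)])
  obtain B where B: "\<And>x y. x \<in> frontier (\<Omega> i) \<Longrightarrow> y \<in> frontier (\<Omega> j) \<Longrightarrow> cmod (kern x y) \<le> B"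
    using kernel_bounded(2)[OF ij] by blast
  have int: "integrable (N j) \<mu>"
    using finite_measure.l2_space_integrable[OF finite_measure_N[OF ij(2)] \<mu>] .
  have "continuous_on (frontier (\<Omega> i)) (\<lambda>x. \<integral>y. kern x y * \<mu> y \<partial>N j)"
    unfolding continuous_on_sequentially comp_def
  proof (intro allI ballI impI, elim conjE)
    fix X a assume a: "a \<in> frontier (\<Omega> i)" and X: "\<forall>n. X n \<in> frontier (\<Omega> i)" "X \<longlonglongrightarrow> a"
    show "(\<lambda>n. \<integral>y. kern (X n) y * \<mu> y \<partial>N j) \<longlonglongrightarrow> (\<integral>y. kern a y * \<mu> y \<partial>N j)"
    proof (rule integral_dominated_convergence[where w = "\<lambda>y. B * cmod (\<mu> y)"])
      show "(\<lambda>y. kern a y * \<mu> y) \<in> borel_measurable (N j)"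
        using kernel_integrable[OF ij a \<mu>] by simp
      show "(\<lambda>y. kern (X n) y * \<mu> y) \<in> borel_measurable (N j)" for n
        using kernel_integrable[OF ij _ \<mu>, of "X n"] X by simp
      show "integrable (N j) (\<lambda>y. B * cmod (\<mu> y))" using int by simp
      show "AE y in N j. norm (kern (X n) y * \<mu> y) \<le> B * cmod (\<mu> y)" for n
        using B X(1) by (intro AE_I2) (auto simp: norm_mult space_N intro!: mult_right_mono)
      show "AE y in N j. (\<lambda>n. kern (X n) y * \<mu> y) \<longlonglongrightarrow> kern a y * \<mu> y"
      proof (intro AE_I2 tendsto_mult tendsto_const)
        fix y assume "y \<in> space (N j)"
        then have "continuous_on (frontier (\<Omega> i)) (\<lambda>x. kern x y)"
          using continuous_on_compose2[OF kernel_bounded(1)[OF ij], of "frontier (\<Omega> i)" "\<lambda>x. (x, y)"]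
          by (simp add: space_N continuous_on_Pair image_subset_iff)
        then show "(\<lambda>n. kern (X n) y) \<longlonglongrightarrow> kern a y"
          using X a unfolding continuous_on_sequentially comp_def by blast
      qed
    qed
  qed
  then show "continuous_on (frontier (\<Omega> i)) (S_op k J \<Omega> i j \<mu>)"
    by (rule continuous_on_eq) (simp add: S_op_def)
qed

text \<open>Linearity of the integral at each fixed \<open>x\<close> gives equality of functions, so
  the argument of \<open>l2_inverse\<close> can simply be rewritten.\<close>

lemma S_op_lincomb:
  assumes ij: "i \<in> {1..J}" "j \<in> {1..J}" "i \<noteq> j"
    and I: "finite I" "\<And>l. l \<in> I \<Longrightarrow> f l \<in> l2_space (N j)"
  shows "S_op k J \<Omega> i j (\<lambda>x. \<Sum>l\<in>I. c l * f l x) = (\<lambda>x. \<Sum>l\<in>I. c l * S_op k J \<Omega> i j (f l) x)"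
proof
  fix x
  show "S_op k J \<Omega> i j (\<lambda>x. \<Sum>l\<in>I. c l * f l x) x = (\<Sum>l\<in>I. c l * S_op k J \<Omega> i j (f l) x)"
  proof (cases "x \<in> frontier (\<Omega> i)")
    case True
    have "(\<integral>y. kern x y * (\<Sum>l\<in>I. c l * f l y) \<partial>N j) = (\<integral>y. (\<Sum>l\<in>I. c l * (kern x y * f l y)) \<partial>N j)"
      by (simp add: sum_distrib_left mult.left_commute)
    also have "\<dots> = (\<Sum>l\<in>I. \<integral>y. c l * (kern x y * f l y) \<partial>N j)"
      using kernel_integrable[OF ij True] I by (intro Bochner_Integration.integral_sum) auto
    finally show ?thesis using True by (simp add: S_op_def)
  qed (simp add: S_op_def)
qed

text \<open>Integration absorbs the null set for every \<open>x\<close>. The two images are the same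
  function, so the later choices in \<open>T_entry\<close> coincide as well.\<close>

lemma S_op_ae_cong:
  assumes ij: "i \<in> {1..J}" "j \<in> {1..J}" "i \<noteq> j"
    and \<mu>: "\<mu> \<in> l2_space (N j)" "\<mu>' \<in> l2_space (N j)" "ae_eq (N j) \<mu> \<mu>'"
  shows "S_op k J \<Omega> i j \<mu> = S_op k J \<Omega> i j \<mu>'"
proof
  fix x
  have "(\<integral>y. kern x y * \<mu> y \<partial>N j) = (\<integral>y. kern x y * \<mu>' y \<partial>N j)" if "x \<in> frontier (\<Omega> i)"
    using kernel_integrable[OF ij that] \<mu>
    by (intro integral_cong_AE) (auto simp: ae_eq_def elim: eventually_mono)
  then show "S_op k J \<Omega> i j \<mu> x = S_op k J \<Omega> i j \<mu>' x" by (simp add: S_op_def)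
qed

lemma T_entry_l2_space:
  assumes "i \<in> {1..J}" "j \<in> {1..J}" "\<mu> \<in> l2_space (N j)"
  shows "T_entry k J \<Omega> i j \<mu> \<in> l2_space (N i)"
  using assms l2_inverse_in_l2_space[OF invertible S_op_l2_space] l2_space_zero
  by (auto simp: T_entry_def)

lemma T_entry_lincomb:
  assumes ij: "i \<in> {1..J}" "j \<in> {1..J}" and I: "finite I" "\<And>l. l \<in> I \<Longrightarrow> f l \<in> l2_space (N j)"
  shows "ae_eq (N i) (T_entry k J \<Omega> i j (\<lambda>x. \<Sum>l\<in>I. c l * f l x))
    (\<lambda>x. \<Sum>l\<in>I. c l * T_entry k J \<Omega> i j (f l) x)"
proof (cases "i = j")
  case False
  then show ?thesis
    using l2_inverse_lincomb[OF invertible[OF ij(1)] I(1) S_op_l2_space[OF ij False I(2)]]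
    by (simp add: T_entry_def S_op_lincomb[OF ij False I])
qed (simp add: T_entry_def ae_eq_refl)

section \<open>Splitting and gluing over the components of the boundary\<close>

lemma N_eq_restrict_M:
  assumes "j \<in> {1..J}"
  shows "N j = restrict_space M (frontier (\<Omega> j))"
proof -
  have "frontier (scatterer J \<Omega>) \<inter> frontier (\<Omega> j) = frontier (\<Omega> j)"
    using assms by (auto simp: frontier_scatterer)
  then show ?thesis by (simp add: boundary_measure_def restrict_restrict_space)
qed

lemma space_M: "space M = (\<Union>j\<in>{1..J}. frontier (\<Omega> j))"
  by (simp add: boundary_measure_def space_restrict_space frontier_scatterer)

lemma frontier_in_sets_M:
  assumes "j \<in> {1..J}"
  shows "frontier (\<Omega> j) \<in> sets M"
proof -
  have "frontier (\<Omega> j) \<subseteq> frontier (scatterer J \<Omega>)" using assms by (auto simp: frontier_scatterer)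
  then show ?thesis by (simp add: boundary_measure_def sets_restrict_space_iff)
qed

text \<open>The frontiers are measurable, finite in number and cover \<open>space M\<close>, so
  finitely many exceptional sets combine into one.\<close>

lemma AE_M_iff: "(AE x in M. P x) \<longleftrightarrow> (\<forall>j\<in>{1..J}. AE x in N j. P x)"
proof -
  have "(AE x in N j. P x) \<longleftrightarrow> (AE x in M. x \<in> frontier (\<Omega> j) \<longrightarrow> P x)" if "j \<in> {1..J}" for j
    unfolding N_eq_restrict_M[OF that] using frontier_in_sets_M[OF that]
    by (subst AE_restrict_space_iff) auto
  then have "(\<forall>j\<in>{1..J}. AE x in N j. P x) \<longleftrightarrow> (\<forall>j\<in>{1..J}. AE x in M. x \<in> frontier (\<Omega> j) \<longrightarrow> P x)"
    by blast
  also have "\<dots> \<longleftrightarrow> (AE x in M. \<forall>j\<in>{1..J}. x \<in> frontier (\<Omega> j) \<longrightarrow> P x)"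
    by (subst AE_finite_all) auto
  also have "\<dots> \<longleftrightarrow> (AE x in M. P x)"
    by (rule AE_cong) (auto simp: space_M)
  finally show ?thesis by simp
qed

lemma ae_eq_M_iff: "ae_eq M f g \<longleftrightarrow> (\<forall>j\<in>{1..J}. ae_eq (N j) f g)"
  unfolding ae_eq_def by (rule AE_M_iff)

lemma l2_space_M_restrict:
  assumes "j \<in> {1..J}" "f \<in> l2_space M"
  shows "f \<in> l2_space (N j)"
  using assms(2) frontier_in_sets_M[OF assms(1)]
    integrable_mult_indicator[OF frontier_in_sets_M[OF assms(1)], of "\<lambda>x. (cmod (f x))\<^sup>2"]
  unfolding N_eq_restrict_M[OF assms(1)] l2_space_def
  by (simp add: measurable_restrict_space1 integrable_restrict_space)

text \<open>Each summand is the extension by zero of a square integrable component. The sum of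
  conditionals is the form in which \<open>T_op\<close> and \<open>rhs_g\<close> are
  written.\<close>

lemma l2_space_M_glue:
  assumes "\<And>j. j \<in> {1..J} \<Longrightarrow> h j \<in> l2_space (N j)"
  shows "(\<lambda>x. \<Sum>j\<in>{1..J}. if x \<in> frontier (\<Omega> j) then h j x else 0) \<in> l2_space M"
proof (rule l2_space_sum)
  fix j assume j: "j \<in> {1..J}"
  have F: "frontier (\<Omega> j) \<inter> space M \<in> sets M" using frontier_in_sets_M[OF j] by auto
  have h: "h j \<in> l2_space (restrict_space M (frontier (\<Omega> j)))"
    using assms[OF j] N_eq_restrict_M[OF j] by simp
  have "(\<lambda>x. if x \<in> frontier (\<Omega> j) then h j x else 0) \<in> borel_measurable M"
    using h F by (subst measurable_restrict_space_iff[symmetric]) (auto simp: l2_space_def)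
  moreover have "integrable M (\<lambda>x. indicator (frontier (\<Omega> j)) x *\<^sub>R (cmod (h j x))\<^sup>2)"
    using h F by (auto simp: l2_space_def integrable_restrict_space Int_commute)
  then have "integrable M (\<lambda>x. (cmod (if x \<in> frontier (\<Omega> j) then h j x else 0))\<^sup>2)"
    by (rule Bochner_Integration.integrable_cong[THEN iffD1, rotated 2]) (auto simp: indicator_def)
  ultimately show "(\<lambda>x. if x \<in> frontier (\<Omega> j) then h j x else 0) \<in> l2_space M"
    by (simp add: l2_space_def)
qed simp

section \<open>The assembled operator and the scattering iterates\<close>

lemma T_op_l2_space:
  assumes "\<mu> \<in> l2_space M"
  shows "T_op k J \<Omega> \<mu> \<in> l2_space M"
  unfolding T_op_def using assms
  by (intro l2_space_M_glue l2_space_sum T_entry_l2_space l2_space_M_restrict) auto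

lemma sum_frontier:
  fixes h :: "nat \<Rightarrow> complex"
  assumes "i \<in> {1..J}" "x \<in> frontier (\<Omega> i)"
  shows "(\<Sum>j\<in>{1..J}. if x \<in> frontier (\<Omega> j) then h j else 0) = h i"
proof -
  have "(if x \<in> frontier (\<Omega> j) then h j else 0) = (if j = i then h i else 0)" if "j \<in> {1..J}" for j
    using frontier_disjoint[OF assms(1) that] assms(2) by auto
  then show ?thesis using assms(1) by simp
qed

lemma T_op_on_frontier:
  assumes "i \<in> {1..J}" "x \<in> frontier (\<Omega> i)"
  shows "T_op k J \<Omega> \<mu> x = (\<Sum>j\<in>{1..J}. T_entry k J \<Omega> i j \<mu> x)"
  unfolding T_op_def by (rule sum_frontier[OF assms])

lemma T_op_ae_cong:
  assumes "\<mu> \<in> l2_space M" "\<mu>' \<in> l2_space M" "ae_eq M \<mu> \<mu>'"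
  shows "T_op k J \<Omega> \<mu> = T_op k J \<Omega> \<mu>'"
proof -
  have "T_entry k J \<Omega> i j \<mu> = T_entry k J \<Omega> i j \<mu>'" if "i \<in> {1..J}" "j \<in> {1..J}" for i j
    using that assms S_op_ae_cong[OF that _ l2_space_M_restrict l2_space_M_restrict, of \<mu> \<mu>']
    by (auto simp: T_entry_def ae_eq_M_iff)
  then show ?thesis unfolding T_op_def by (intro ext sum.cong if_cong refl) simp
qed

text \<open>On each component the operator is a row sum of entries, each linear almost everywhere;
  exchanging the two finite sums gives the claim.\<close>

lemma T_op_lincomb:
  assumes "finite I" "\<And>l. l \<in> I \<Longrightarrow> f l \<in> l2_space M"
  shows "ae_eq M (T_op k J \<Omega> (\<lambda>x. \<Sum>l\<in>I. c l * f l x)) (\<lambda>x. \<Sum>l\<in>I. c l * T_op k J \<Omega> (f l) x)"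
  unfolding ae_eq_M_iff
proof
  fix i assume i: "i \<in> {1..J}"
  have on: "ae_eq (N i) (T_op k J \<Omega> \<mu>) (\<lambda>x. \<Sum>j\<in>{1..J}. T_entry k J \<Omega> i j \<mu> x)" for \<mu>
    unfolding ae_eq_def by (rule AE_I2) (simp add: space_N T_op_on_frontier[OF i])
  note on[of "\<lambda>x. \<Sum>l\<in>I. c l * f l x"]
  also have "ae_eq (N i) (\<lambda>x. \<Sum>j\<in>{1..J}. T_entry k J \<Omega> i j (\<lambda>x. \<Sum>l\<in>I. c l * f l x) x)
      (\<lambda>x. \<Sum>j\<in>{1..J}. \<Sum>l\<in>I. c l * T_entry k J \<Omega> i j (f l) x)"
    using i assms by (intro ae_eq_sum T_entry_lincomb l2_space_M_restrict) auto
  also have "(\<lambda>x. \<Sum>j\<in>{1..J}. \<Sum>l\<in>I. c l * T_entry k J \<Omega> i j (f l) x)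
      = (\<lambda>x. \<Sum>l\<in>I. c l * (\<Sum>j\<in>{1..J}. T_entry k J \<Omega> i j (f l) x))"
    by (subst sum.swap) (simp add: sum_distrib_left)
  also have "ae_eq (N i) \<dots> (\<lambda>x. \<Sum>l\<in>I. c l * T_op k J \<Omega> (f l) x)"
    using assms(1) by (intro ae_eq_sum ae_eq_cmult ae_eq_sym[OF on])
  finally show "ae_eq (N i) (T_op k J \<Omega> (\<lambda>x. \<Sum>l\<in>I. c l * f l x)) (\<lambda>x. \<Sum>l\<in>I. c l * T_op k J \<Omega> (f l) x)" .
qed

lemma rhs_g_l2_space:
  assumes "helmholtz_solution k u"
  shows "rhs_g k J \<Omega> u \<in> l2_space M"
  unfolding rhs_g_def
proof (rule l2_space_M_glue)
  fix j assume j: "j \<in> {1..J}"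
  show "l2_inverse (N j) (one_minus (S_op k J \<Omega> j j)) (boundary_data k J \<Omega> u) \<in> l2_space (N j)"
    by (intro l2_inverse_in_l2_space[OF invertible[OF j]] continuous_on_l2_space[OF j]
        continuous_on_boundary_data[OF assms] continuous_on_normal[OF j])
qed

lemma scattering_iter_l2_space:
  assumes "helmholtz_solution k u"
  shows "scattering_iter k J \<Omega> u m \<in> l2_space M"
  by (induction m) (auto intro: rhs_g_l2_space[OF assms] T_op_l2_space)

end

section \<open>Expansion of the ORTHODIR directions\<close>

lemma next_coeff_collects:
  fixes \<eta> :: "nat \<Rightarrow> complex"
  shows "(\<Sum>i\<le>j. \<gamma> i j * \<eta> i) - (\<Sum>i\<le>j. \<gamma> i j * \<eta> (Suc i)) + (\<Sum>l\<le>j. \<beta> l j * (\<Sum>i\<le>l. \<gamma> i l * \<eta> i))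
    = (\<Sum>i\<le>Suc j. next_coeff \<gamma> \<beta> j i * \<eta> i)"
proof -
  have 1: "(\<Sum>i\<le>j. \<gamma> i j * \<eta> i) = (\<Sum>i\<le>Suc j. (if i \<le> j then \<gamma> i j else 0) * \<eta> i)"
    by simp
  \<comment> \<open>The shifted sum has no term at index 0. The test \<open>1 \<le> i\<close>
    enforces this, since the truncated \<open>0 - 1\<close> would otherwise pick up
    \<open>\<gamma> 0 j\<close>.\<close>
  have 2: "(\<Sum>i\<le>j. \<gamma> i j * \<eta> (Suc i)) = (\<Sum>i\<le>Suc j. (if 1 \<le> i then \<gamma> (i - 1) j else 0) * \<eta> i)"
    by (subst sum.atMost_Suc_shift) simp
  \<comment> \<open>The triangle \<open>i \<le> l \<le> j\<close> is summed in the other order. For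
    \<open>i = Suc j\<close> the inner sum is empty, which lets the range match that of the other
    two sums.\<close>
  have "(\<Sum>l\<le>j. \<beta> l j * (\<Sum>i\<le>l. \<gamma> i l * \<eta> i))
      = (\<Sum>l\<in>{..j}. \<Sum>i\<in>{i \<in> {..Suc j}. i \<le> l}. \<beta> l j * \<gamma> i l * \<eta> i)"
    by (auto simp: sum_distrib_left mult.assoc intro!: sum.cong)
  also have "\<dots> = (\<Sum>i\<in>{..Suc j}. \<Sum>l\<in>{l \<in> {..j}. i \<le> l}. \<beta> l j * \<gamma> i l * \<eta> i)"
    by (rule sum.swap_restrict) auto
  also have "\<dots> = (\<Sum>i\<le>Suc j. (\<Sum>l\<in>{i..j}. \<beta> l j * \<gamma> i l) * \<eta> i)"
    unfolding sum_distrib_right by (intro sum.cong) auto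
  finally show ?thesis
    unfolding next_coeff_def distrib_right left_diff_distrib sum.distrib sum_subtractf 1 2 by simp
qed

text \<open>A new column depends on columns up to \<open>j\<close> alone; this makes the
  identification rule a legitimate recursion.\<close>

lemma next_coeff_cong:
  assumes "\<And>i l. l \<le> j \<Longrightarrow> \<gamma> i l = \<gamma>' i l"
  shows "next_coeff \<gamma> \<beta> j i = next_coeff \<gamma>' \<beta> j i"
  using assms by (simp add: next_coeff_def)

text \<open>Column \<open>Suc j\<close> draws on all earlier columns, so the recursion carries the
  entire table: \<open>G n\<close> is the table with columns up to \<open>n\<close> filled in, and
  \<gamma> takes column \<open>l\<close> from \<open>G l\<close>.\<close>

lemma next_coeff_solution_exists:
  "\<exists>\<gamma>. \<gamma> 0 0 = 1 \<and> (\<forall>j i. \<gamma> i (Suc j) = next_coeff \<gamma> \<beta> j i)"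
proof -
  define G where "G = rec_nat (\<lambda>i l. if i = 0 \<and> l = 0 then 1 else 0)
    (\<lambda>j \<gamma> i l. if l = Suc j then next_coeff \<gamma> \<beta> j i else \<gamma> i l)"
  have G0: "G 0 0 0 = 1" by (simp add: G_def)
  have GS: "G (Suc j) i l = (if l = Suc j then next_coeff (G j) \<beta> j i else G j i l)" for i j l
    by (simp add: G_def)
  \<comment> \<open>Later stages overwrite only their own new column.\<close>
  have stable: "G n i l = G l i l" if "l \<le> n" for n i l
    using that by (induction n rule: dec_induct) (auto simp: GS)
  have "G (Suc j) i (Suc j) = next_coeff (\<lambda>i l. G l i l) \<beta> j i" for i j
    unfolding GS if_P[OF refl] by (intro next_coeff_cong stable)
  then show ?thesis using G0 by (intro exI[of _ "\<lambda>i l. G l i l"]) simp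
qed

text \<open>Applying \<open>T_op\<close> to the expansion of \<open>p j\<close> shifts every index
  by one, as \<open>T_op\<close> maps each iterate to its successor. The second relation inserts the
  expansions of all earlier directions and collects terms pointwise.\<close>

lemma (in multiple_scatterer) orthodir_direction_expansion:
  assumes u: "helmholtz_solution k u"
    and p: "\<And>l. l \<le> j \<Longrightarrow> p l \<in> l2_space M"
    and exp: "\<And>l. l \<le> j \<Longrightarrow> ae_eq M (p l) (\<lambda>x. \<Sum>i\<le>l. \<gamma> i l * scattering_iter k J \<Omega> u i x)"
  shows "ae_eq M (\<lambda>x. one_minus (T_op k J \<Omega>) (p j) x + (\<Sum>i\<le>j. \<beta> i j * p i x))
      (\<lambda>x. (\<Sum>i\<le>j. \<gamma> i j * scattering_iter k J \<Omega> u i x)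
        - (\<Sum>i\<le>j. \<gamma> i j * scattering_iter k J \<Omega> u (Suc i) x) + (\<Sum>i\<le>j. \<beta> i j * p i x))" (is ?A)
    and "ae_eq M (\<lambda>x. (\<Sum>i\<le>j. \<gamma> i j * scattering_iter k J \<Omega> u i x)
        - (\<Sum>i\<le>j. \<gamma> i j * scattering_iter k J \<Omega> u (Suc i) x) + (\<Sum>i\<le>j. \<beta> i j * p i x))
      (\<lambda>x. \<Sum>i\<le>Suc j. next_coeff \<gamma> \<beta> j i * scattering_iter k J \<Omega> u i x)" (is ?B)
proof -
  let ?\<eta> = "scattering_iter k J \<Omega> u"
  have \<eta>: "?\<eta> i \<in> l2_space M" for i using u by (rule scattering_iter_l2_space)
  have eq: "T_op k J \<Omega> (p j) = T_op k J \<Omega> (\<lambda>x. \<Sum>i\<le>j. \<gamma> i j * ?\<eta> i x)"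
    using \<eta> by (intro T_op_ae_cong[OF p _ exp] l2_space_lincomb) auto
  have "ae_eq M (T_op k J \<Omega> (p j)) (\<lambda>x. \<Sum>i\<le>j. \<gamma> i j * T_op k J \<Omega> (?\<eta> i) x)"
    unfolding eq using \<eta> by (intro T_op_lincomb) auto
  then have "ae_eq M (T_op k J \<Omega> (p j)) (\<lambda>x. \<Sum>i\<le>j. \<gamma> i j * ?\<eta> (Suc i) x)" by simp
  then show ?A unfolding one_minus_def by (intro ae_eq_add ae_eq_diff exp order_refl ae_eq_refl)
  have "ae_eq M (\<lambda>x. (\<Sum>i\<le>j. \<gamma> i j * ?\<eta> i x) - (\<Sum>i\<le>j. \<gamma> i j * ?\<eta> (Suc i) x) + (\<Sum>l\<le>j. \<beta> l j * p l x))
     (\<lambda>x. (\<Sum>i\<le>j. \<gamma> i j * ?\<eta> i x) - (\<Sum>i\<le>j. \<gamma> i j * ?\<eta> (Suc i) x)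
        + (\<Sum>l\<le>j. \<beta> l j * (\<Sum>i\<le>l. \<gamma> i l * ?\<eta> i x)))"
    by (intro ae_eq_add[OF ae_eq_refl] ae_eq_sum ae_eq_cmult exp) auto
  then show ?B unfolding next_coeff_collects[where \<eta> = "\<lambda>i. ?\<eta> i x" for x] .
qed

text \<open>The second half speaks about arbitrary representations, so the identification rule is
  valid beyond the table exhibited in the first half. The start \<open>\<gamma> 0 0 = 1\<close>
  reflects that \<open>p 0\<close>, the right-hand side and \<open>\<eta> 0\<close> agree.\<close>

theorem corollary7:
  fixes k :: real and J N :: nat and \<Omega> :: "nat \<Rightarrow> (real^'n) set"
    and u_inc :: "real^'n \<Rightarrow> complex"
    and \<mu> r p \<eta> :: "nat \<Rightarrow> real^'n \<Rightarrow> complex"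
    and \<alpha> :: "nat \<Rightarrow> complex" and \<beta> :: "nat \<Rightarrow> nat \<Rightarrow> complex"
    and M :: "(real^'n) measure"
  assumes dim: "CARD('n) = 2 \<or> CARD('n) = 3"
    and k_pos: "k > 0"
    and J_pos: "J \<ge> 1"
    and obstacles: "\<forall>j\<in>{1..J}. smooth_obstacle (\<Omega> j)"
    and disjoint: "\<forall>i\<in>{1..J}. \<forall>j\<in>{1..J}. i \<noteq> j \<longrightarrow> \<Omega> i \<inter> \<Omega> j = {}"
    and invertible: "\<forall>j\<in>{1..J}.
      boundedly_invertible (boundary_measure (\<Omega> j)) (one_minus (S_op k J \<Omega> j j))"
    and incident: "helmholtz_solution k u_inc"
    and M_eq: "M = boundary_measure (scatterer J \<Omega>)"
    and \<eta>_eq: "\<eta> = scattering_iter k J \<Omega> u_inc"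
    and algorithm: "orthodir M (one_minus (T_op k J \<Omega>)) (rhs_g k J \<Omega> u_inc) N \<mu> r p \<alpha> \<beta>"
  shows "(\<exists>\<gamma>. \<gamma> 0 0 = 1 \<and>
            (\<forall>j<N. \<forall>i\<le>Suc j. \<gamma> i (Suc j) = next_coeff \<gamma> \<beta> j i) \<and>
            (\<forall>j\<le>N. ae_eq M (p j) (\<lambda>x. \<Sum>i\<le>j. \<gamma> i j * \<eta> i x))) \<and>
         (\<forall>\<gamma>. \<forall>j<N. (\<forall>l\<le>j. ae_eq M (p l) (\<lambda>x. \<Sum>i\<le>l. \<gamma> i l * \<eta> i x)) \<longrightarrow>
            ae_eq M (p (Suc j))
              (\<lambda>x. one_minus (T_op k J \<Omega>) (p j) x + (\<Sum>i\<le>j. \<beta> i j * p i x)) \<and>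
            ae_eq M (\<lambda>x. one_minus (T_op k J \<Omega>) (p j) x + (\<Sum>i\<le>j. \<beta> i j * p i x))
              (\<lambda>x. (\<Sum>i\<le>j. \<gamma> i j * \<eta> i x) - (\<Sum>i\<le>j. \<gamma> i j * \<eta> (Suc i) x)
                   + (\<Sum>i\<le>j. \<beta> i j * p i x)) \<and>
            ae_eq M (\<lambda>x. (\<Sum>i\<le>j. \<gamma> i j * \<eta> i x) - (\<Sum>i\<le>j. \<gamma> i j * \<eta> (Suc i) x)
                   + (\<Sum>i\<le>j. \<beta> i j * p i x))
              (\<lambda>x. \<Sum>i\<le>Suc j. next_coeff \<gamma> \<beta> j i * \<eta> i x))"
    (is "?representation \<and> ?identification")
proof -
  interpret multiple_scatterer k J \<Omega>
    using dim k_pos J_pos obstacles disjoint invertible by unfold_locales auto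
  have p_l2: "p l \<in> l2_space M" if "l \<le> N" for l
    using algorithm that by (auto simp: orthodir_def)
  have p_0: "ae_eq M (p 0) (\<eta> 0)"
    using algorithm by (simp add: orthodir_def \<eta>_eq)
  have p_Suc: "ae_eq M (p (Suc j)) (\<lambda>x. one_minus (T_op k J \<Omega>) (p j) x + (\<Sum>i\<le>j. \<beta> i j * p i x))"
    if "j < N" for j
    using algorithm that unfolding orthodir_def by blast
  have step:
    "ae_eq M (\<lambda>x. one_minus (T_op k J \<Omega>) (p j) x + (\<Sum>i\<le>j. \<beta> i j * p i x))
      (\<lambda>x. (\<Sum>i\<le>j. \<gamma> i j * \<eta> i x) - (\<Sum>i\<le>j. \<gamma> i j * \<eta> (Suc i) x) + (\<Sum>i\<le>j. \<beta> i j * p i x))"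
    "ae_eq M (\<lambda>x. (\<Sum>i\<le>j. \<gamma> i j * \<eta> i x) - (\<Sum>i\<le>j. \<gamma> i j * \<eta> (Suc i) x) + (\<Sum>i\<le>j. \<beta> i j * p i x))
      (\<lambda>x. \<Sum>i\<le>Suc j. next_coeff \<gamma> \<beta> j i * \<eta> i x)"
    if "j < N" "\<And>l. l \<le> j \<Longrightarrow> ae_eq M (p l) (\<lambda>x. \<Sum>i\<le>l. \<gamma> i l * \<eta> i x)" for \<gamma> j
    using orthodir_direction_expansion[OF incident, of j p \<gamma> \<beta>] p_l2 that
    by (simp_all add: M_eq \<eta>_eq)
  obtain \<gamma> where \<gamma>: "\<gamma> 0 0 = 1" "\<And>j i. \<gamma> i (Suc j) = next_coeff \<gamma> \<beta> j i"
    using next_coeff_solution_exists[of \<beta>] by auto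
  \<comment> \<open>Strong induction is required: the orthogonalisation sum in the new direction
    involves all preceding directions.\<close>
  have "ae_eq M (p j) (\<lambda>x. \<Sum>i\<le>j. \<gamma> i j * \<eta> i x)" if "j \<le> N" for j
    using that
  proof (induction j rule: less_induct)
    case (less j)
    show ?case
    proof (cases j)
      case 0
      then show ?thesis using p_0 \<gamma>(1) by simp
    next
      case (Suc m)
      have m: "m < N" using less.prems Suc by simp
      have IH: "ae_eq M (p l) (\<lambda>x. \<Sum>i\<le>l. \<gamma> i l * \<eta> i x)" if "l \<le> m" for l
        using less.IH[of l] that Suc less.prems by simp
      note p_Suc[OF m]
      also note step(1)[OF m IH]
      also note step(2)[OF m IH]
      finally show ?thesis unfolding Suc \<gamma>(2) .
    qed
  qed
  then have ?representation using \<gamma> by blast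
  moreover have ?identification using p_Suc step by blast
  ultimately show ?thesis ..
qed

end
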